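(* Let $P_n$ be the path on $n$ vertices and consider a single cop chasing an invisible robber. Then \[\frac{n}{2}\left(1-O\left(\frac{\log n}{n}\right)\right)\leq \mathrm{idct}(P_n)\leq \frac{n-1}{2}.\] In particular $\mathrm{idct}(P_n)=(1+o(1))n/2$ and the cost of drunkenness for the invisible robber is $F_i(P_n)=\mathrm{ict}(P_n)/\mathrm{idct}(P_n)=2+o(1)$, where asymptotics are as $n\to\infty$.
   Context: $P_n$ has vertices $\{0,\dots,n-1\}$ and edges $\{i-1,i\}$; its cop number is $c(P_n)=1$. Invisible robber games on a graph $G=(V,E)$ with $k$ cops: the cops choose initial positions $x\in V^k$, then the robber's initial vertex is chosen; in each round first each cop moves along an edge or stays, then the robber moves. The robber is invisible: the cops do not know his position until capture, so their (possibly randomized) strategy cannot depend on the robber's positions. The capture time is the first time a cop and the robber occupy the same vertex. Adversarial version: the robber chooses his initial vertex $y$ and his moves (he may stay put) to maximize capture time; $\mathrm{ict}_{x,y}(G,k)$ is the expected capture time from $(x,y)$ when both cops and robber play optimally, $\mathrm{ict}(G,k)=\min_{x}\max_{y}\mathrm{ict}_{x,y}(G,k)$, and $\mathrm{ict}(G)=\mathrm{ict}(G,c(G))$. Drunk version: the robber's initial vertex is uniformly random in $V$ and in each round he moves to a uniformly random neighbour of his current vertex (open neighbourhood), independently of the cops; $\mathrm{idct}_x(G,k)$ is the smallest expected capture time achievable by the cops from $x$, $\mathrm{idct}(G,k)=\min_{x}\mathrm{idct}_x(G,k)$, $\mathrm{idct}(G)=\mathrm{idct}(G,c(G))$. The cost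 of drunkenness for the invisible robber is $F_i(G)=\mathrm{ict}(G)/\mathrm{idct}(G)$. *)

theory Defs
  imports "HOL-Probability.Probability" "HOL-Library.Landau_Symbols"
begin

text \<open>
  A graph is a pair \<open>(V, E)\<close>; the definitions below are meant for finite simple graphs, that is,
  \<open>V\<close> is finite and nonempty and every element of \<open>E\<close> is a two-element subset of \<open>V\<close>.
\<close>

type_synonym 'a graph = "'a set \<times> 'a set set"

abbreviation verts :: "'a graph \<Rightarrow> 'a set" where "verts \<equiv> fst"
abbreviation edges :: "'a graph \<Rightarrow> 'a set set" where "edges \<equiv> snd"

definition path_graph :: "nat \<Rightarrow> nat graph" where
  "path_graph n = ({0..<n}, {{i - 1, i} | i. 1 \<le> i \<and> i < n})"

definition neighbours :: "'a graph \<Rightarrow> 'a \<Rightarrow> 'a set" where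
  "neighbours G v = {u. {v, u} \<in> edges G}"

definition move :: "'a graph \<Rightarrow> 'a \<Rightarrow> 'a \<Rightarrow> bool" where
  "move G u v \<longleftrightarrow> v = u \<or> v \<in> neighbours G u"


section \<open>Positions, capture time\<close>

definition cop_positions :: "'a graph \<Rightarrow> nat \<Rightarrow> 'a list set" where
  "cop_positions G k = {x. length x = k \<and> set x \<subseteq> verts G}"

definition cop_move :: "'a graph \<Rightarrow> 'a list \<Rightarrow> 'a list \<Rightarrow> bool" where
  "cop_move G = list_all2 (move G)"

text \<open>
  \<open>X t\<close> and \<open>Y t\<close> are the positions after round \<open>t\<close> (round \<open>0\<close> is the initial placement). The cops
  move first, so in round \<open>t > 0\<close> the robber can be caught either by a cop moving onto his vertex
  \<open>Y (t - 1)\<close> or by moving onto a cop himself.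
\<close>

definition captured :: "(nat \<Rightarrow> 'a list) \<Rightarrow> (nat \<Rightarrow> 'a) \<Rightarrow> nat \<Rightarrow> bool" where
  "captured X Y t \<longleftrightarrow> Y t \<in> set (X t) \<or> (t > 0 \<and> Y (t - 1) \<in> set (X t))"

text \<open>The infimum of the empty set is \<open>\<infinity>\<close>: the robber is never caught.\<close>

definition capture_time :: "(nat \<Rightarrow> 'a list) \<Rightarrow> (nat \<Rightarrow> 'a) \<Rightarrow> ennreal" where
  "capture_time X Y = (INF t\<in>{t. captured X Y t}. of_nat t)"


section \<open>The cop number (visible robber)\<close>

text \<open>
  \<open>\<sigma> [Y 0, \<dots>, Y (t - 1)]\<close> is the cops' position in round \<open>t\<close>; in particular \<open>\<sigma> []\<close> is chosen before the
  robber chooses \<open>Y 0\<close>. A deterministic strategy wins iff it beats every robber walk.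
\<close>

definition visible_cop_strategies :: "'a graph \<Rightarrow> nat \<Rightarrow> ('a list \<Rightarrow> 'a list) set" where
  "visible_cop_strategies G k =
     {\<sigma>. \<sigma> [] \<in> cop_positions G k \<and> (\<forall>h y. cop_move G (\<sigma> h) (\<sigma> (h @ [y])))}"

definition robber_walks :: "'a graph \<Rightarrow> (nat \<Rightarrow> 'a) set" where
  "robber_walks G = {Y. Y 0 \<in> verts G \<and> (\<forall>t. move G (Y t) (Y (Suc t)))}"

definition cops_win :: "'a graph \<Rightarrow> nat \<Rightarrow> bool" where
  "cops_win G k \<longleftrightarrow>
     (\<exists>\<sigma>\<in>visible_cop_strategies G k. \<forall>Y\<in>robber_walks G. \<exists>t. captured (\<lambda>t. \<sigma> (map Y [0..<t])) Y t)"

definition cop_number :: "'a graph \<Rightarrow> nat" where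
  "cop_number G = (LEAST k. cops_win G k)"

lemma cop_number_path_graph:
  assumes "n \<ge> 1"
  shows "cop_number (path_graph n) = 1"
proof -
  have mv: "v \<le> Suc u \<and> u \<le> Suc v" "u < n \<Longrightarrow> v < n" if "move (path_graph n) u v" for u v
    using that by (auto simp: move_def neighbours_def path_graph_def doubleton_eq_iff)
  have "\<not> cops_win (path_graph n) 0"
  proof
    assume "cops_win (path_graph n) 0"
    then obtain \<sigma> where \<sigma>: "\<sigma> \<in> visible_cop_strategies (path_graph n) 0"
      and win: "\<And>Y. Y \<in> robber_walks (path_graph n) \<Longrightarrow> \<exists>t. captured (\<lambda>t. \<sigma> (map Y [0..<t])) Y t"
      unfolding cops_win_def by blast
    have "\<sigma> h = []" for h
    proof (induction h rule: rev_induct)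
      case Nil
      show ?case using \<sigma> by (simp add: visible_cop_strategies_def cop_positions_def)
    next
      case (snoc y h)
      have "cop_move (path_graph n) (\<sigma> h) (\<sigma> (h @ [y]))"
        using \<sigma> by (simp add: visible_cop_strategies_def)
      then show ?case by (simp add: snoc cop_move_def)
    qed
    moreover have "(\<lambda>_. 0) \<in> robber_walks (path_graph n)"
      using assms by (simp add: robber_walks_def move_def path_graph_def)
    ultimately show False using win[of "\<lambda>_. 0"] by (simp add: captured_def)
  qed
  moreover have "cops_win (path_graph n) 1"
  proof -
    define \<sigma> :: "nat list \<Rightarrow> nat list" where "\<sigma> h = [min (length h) (n - 1)]" for h
    have "move (path_graph n) (min l (n - 1)) (min (Suc l) (n - 1))" for l
      by (cases "Suc l < n")
         (auto simp: move_def neighbours_def path_graph_def min_def intro!: exI[of _ "Suc l"])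
    then have "\<sigma> \<in> visible_cop_strategies (path_graph n) 1"
      using assms
      by (auto simp: visible_cop_strategies_def cop_positions_def cop_move_def \<sigma>_def path_graph_def)
    moreover have "\<exists>t. captured (\<lambda>t. \<sigma> (map Y [0..<t])) Y t"
      if Y: "Y \<in> robber_walks (path_graph n)" for Y
    proof (rule ccontr)
      assume free: "\<nexists>t. captured (\<lambda>t. \<sigma> (map Y [0..<t])) Y t"
      have free1: "Y t \<noteq> min t (n - 1)" "Y t \<noteq> min (Suc t) (n - 1)" for t
        using free spec[of "\<lambda>t. \<not> captured (\<lambda>t. \<sigma> (map Y [0..<t])) Y t" "Suc t"]
        by (auto simp: captured_def \<sigma>_def)
      have step: "move (path_graph n) (Y t) (Y (Suc t))" for t
        using Y by (simp add: robber_walks_def)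
      have "min t (n - 1) < Y t" for t
      proof (induction t)
        case 0
        then show ?case using free1(1)[of 0] by simp
      next
        case (Suc t)
        then show ?case using mv(1)[OF step[of t]] free1(2)[of t] free1(1)[of "Suc t"] by linarith
      qed
      moreover have "Y t < n" for t
      proof (induction t)
        case 0
        then show ?case using Y by (simp add: robber_walks_def path_graph_def)
      next
        case (Suc t)
        then show ?case using mv(2)[OF step[of t]] by simp
      qed
      ultimately show False
        by (metis Suc_pred' assms less_Suc_eq_le linorder_not_less min.idem order_less_le_trans zero_less_one)
    qed
    ultimately show ?thesis unfolding cops_win_def by blast
  qed
  ultimately show ?thesis
    unfolding cop_number_def by (intro Least_equality) (auto simp: Suc_le_eq intro: gr0I)
qed


section \<open>Strategies against an invisible robber\<close>

text \<open>
  The cops learn nothing about the robber before the capture, so their pure strategies are just walks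
  in \<open>V\<^sup>k\<close>, and a randomized strategy starting from \<open>x\<close> is a probability distribution on the space of
  such walks.
\<close>

definition cop_strategies :: "'a graph \<Rightarrow> nat \<Rightarrow> 'a list \<Rightarrow> (nat \<Rightarrow> 'a list) measure set" where
  "cop_strategies G k x =
     {M. prob_space M \<and>
         sets M = sets (PiM UNIV (\<lambda>_. count_space (cop_positions G k))) \<and>
         (AE X in M. X 0 = x \<and> (\<forall>t. cop_move G (X t) (X (Suc t))))}"


section \<open>Adversarial robber\<close>

text \<open>
  The robber sees the cops: \<open>\<rho> [X 0, \<dots>, X t]\<close> is his position at the end of round \<open>t\<close>. Since \<open>\<rho>\<close> is
  deterministic there is no need to record his own past moves.
\<close>

definition robber_strategies :: "'a graph \<Rightarrow> 'a \<Rightarrow> ('a list list \<Rightarrow> 'a) set" where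
  "robber_strategies G y =
     {\<rho>. (\<forall>x. \<rho> [x] = y) \<and> (\<forall>h x. h \<noteq> [] \<longrightarrow> move G (\<rho> h) (\<rho> (h @ [x])))}"

definition robber_response :: "('a list list \<Rightarrow> 'a) \<Rightarrow> (nat \<Rightarrow> 'a list) \<Rightarrow> nat \<Rightarrow> 'a" where
  "robber_response \<rho> X t = \<rho> (map X [0..<Suc t])"

text \<open>
  Expected capture time when the cops use \<open>M\<close> and the robber starts at \<open>y\<close> and plays optimally
  against \<open>M\<close>; randomizing over \<open>\<rho>\<close> would not increase the supremum.
\<close>

definition ict_against :: "'a graph \<Rightarrow> (nat \<Rightarrow> 'a list) measure \<Rightarrow> 'a \<Rightarrow> ennreal" where
  "ict_against G M y =
     (SUP \<rho>\<in>robber_strategies G y. \<integral>\<^sup>+X. capture_time X (robber_response \<rho> X) \<partial>M)"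

text \<open>
  The robber knows \<open>x\<close> when he chooses \<open>y\<close>, but the cops have to use one and the same \<open>M\<close> for all \<open>y\<close>,
  because they do not see \<open>y\<close>: hence the supremum over \<open>y\<close> stands inside the infimum over \<open>M\<close>.
\<close>

definition ict_k :: "'a graph \<Rightarrow> nat \<Rightarrow> ennreal" where
  "ict_k G k =
     (INF x\<in>cop_positions G k. INF M\<in>cop_strategies G k x. SUP y\<in>verts G. ict_against G M y)"

definition ict :: "'a graph \<Rightarrow> ennreal" where
  "ict G = ict_k G (cop_number G)"


section \<open>Drunk robber\<close>

text \<open>An isolated vertex, which has no neighbour to move to, is never left.\<close>

definition drunk_step :: "'a graph \<Rightarrow> 'a \<Rightarrow> 'a pmf" where
  "drunk_step G v = (if neighbours G v = {} then return_pmf v else pmf_of_set (neighbours G v))"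

text \<open>Distribution of the position after round \<open>t\<close> given the positions \<open>\<omega> 0, \<dots>, \<omega> (t - 1)\<close>.\<close>

definition drunk_kernel :: "'a graph \<Rightarrow> nat \<Rightarrow> (nat \<Rightarrow> 'a) \<Rightarrow> 'a measure" where
  "drunk_kernel G t \<omega> =
     measure_pmf (case t of 0 \<Rightarrow> pmf_of_set (verts G) | Suc s \<Rightarrow> drunk_step G (\<omega> s))"

lemma Ionescu_Tulcea_drunk_kernel: "Ionescu_Tulcea (drunk_kernel G) (\<lambda>_. count_space UNIV)"
proof (rule Ionescu_Tulcea.intro)
  fix t :: nat
  show "drunk_kernel G t \<in> measurable (PiM {0..<t} (\<lambda>_. count_space UNIV)) (subprob_algebra (count_space UNIV))"
  proof (cases t)
    case 0
    show ?thesis unfolding drunk_kernel_def 0 nat.case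
      by (rule measurable_const) (simp add: space_subprob_algebra measure_pmf.subprob_space_axioms)
  next
    case (Suc s)
    have "(\<lambda>v. measure_pmf (drunk_step G v)) \<in> measurable (count_space UNIV) (subprob_algebra (count_space UNIV))"
      by (simp add: space_subprob_algebra measure_pmf.subprob_space_axioms)
    moreover have "(\<lambda>\<omega>. \<omega> s) \<in> measurable (PiM {0..<t} (\<lambda>_. count_space UNIV)) (count_space UNIV)"
      using Suc by (intro measurable_component_singleton) simp
    ultimately show ?thesis
      unfolding drunk_kernel_def Suc nat.case
      using measurable_compose by blast
  qed
next
  fix t \<omega>
  show "prob_space (drunk_kernel G t \<omega>)"
    unfolding drunk_kernel_def by (rule measure_pmf.prob_space_axioms)
qed

interpretation drunk: Ionescu_Tulcea "drunk_kernel G" "\<lambda>_. count_space UNIV" for G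
  by (rule Ionescu_Tulcea_drunk_kernel)

definition drunk_walk :: "'a graph \<Rightarrow> (nat \<Rightarrow> 'a) measure" where
  "drunk_walk G = drunk.PF.lim G"

lemma prob_space_drunk_walk: "prob_space (drunk_walk G)"
proof
  have "emeasure (drunk_walk G) (drunk.PF.emb UNIV {} {\<lambda>_. undefined}) =
        emeasure (drunk.CI G {}) {\<lambda>_. undefined}"
    unfolding drunk_walk_def by (rule drunk.lim) (auto simp: sets_PiM_empty)
  moreover have "drunk.PF.emb UNIV {} {\<lambda>_. undefined} = space (drunk_walk G)"
    by (auto simp: drunk_walk_def prod_emb_def space_PiM restrict_def)
  moreover have "emeasure (drunk.CI G {}) {\<lambda>_. undefined} = 1"
    using prob_space.emeasure_space_1[OF drunk.PF.prob_space_P[of "{}" G]]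
    by (simp add: drunk.CI_def space_PiM)
  ultimately show "emeasure (drunk_walk G) (space (drunk_walk G)) = 1" by simp
qed

lemma emeasure_drunk_walk:
  fixes w :: "nat \<Rightarrow> 'a"
  shows "emeasure (drunk_walk G) {Y. \<forall>i\<le>t. Y i = w i} =
         ennreal (pmf (pmf_of_set (verts G)) (w 0) * (\<Prod>i<t. pmf (drunk_step G (w i)) (w (Suc i))))"
proof -
  let ?M = "\<lambda>n::nat. PiM {0..<n} (\<lambda>_. count_space (UNIV :: 'a set))"
  let ?q = "\<lambda>i. pmf (case i of 0 \<Rightarrow> pmf_of_set (verts G) | Suc s \<Rightarrow> drunk_step G (w s)) (w i)"
  have meas: "{restrict w {0..<m}} \<in> sets (?M m)" for m
  proof -
    have "{restrict w {0..<m}} = PiE {0..<m} (\<lambda>i. {restrict w {0..<m} i})"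
      by (rule PiE_singleton[symmetric]) (simp add: extensional_def)
    then show ?thesis by (simp only:) (rule sets_PiM_I_finite, auto)
  qed
  have C: "emeasure (drunk.C G 0 m (\<lambda>_. undefined)) {restrict w {0..<m}} = ennreal (\<Prod>i<m. ?q i)" for m
  proof (induction m)
    case 0
    show ?case using meas[of 0] by (simp add: restrict_def sets_PiM_empty)
  next
    case (Suc m)
    let ?C = "drunk.C G 0 m (\<lambda>_. undefined)"
    have u: "(\<lambda>_. undefined) \<in> space (?M 0)" by (simp add: space_PiM)
    have sp: "space ?C = space (?M m)" and st: "sets ?C = sets (?M m)"
      using drunk.space_C[OF u, of G m] drunk.sets_C[OF u, of G m] by simp_all
    have "emeasure (drunk.C G 0 (Suc m) (\<lambda>_. undefined)) {restrict w {0..<Suc m}} =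
          (\<integral>\<^sup>+\<omega>. emeasure (drunk.eP G m \<omega>) {restrict w {0..<Suc m}} \<partial>?C)"
      using drunk.measurable_eP[of G m] meas[of "Suc m"]
      by (simp, intro emeasure_bind[where N="?M (Suc m)"])
         (auto simp: sp measurable_cong_sets[OF st refl])
    also have "\<dots> = (\<integral>\<^sup>+\<omega>. ennreal (?q m) * indicator {restrict w {0..<m}} \<omega> \<partial>?C)"
    proof (intro nn_integral_cong)
      fix \<omega> assume "\<omega> \<in> space ?C"
      then have \<omega>: "\<omega> \<in> space (?M m)" by (simp add: sp)
      then have ext: "\<omega> \<in> extensional {0..<m}" by (simp add: space_PiM PiE_def)
      have eq: "fun_upd \<omega> m x = restrict w {0..<Suc m} \<longleftrightarrow> \<omega> = restrict w {0..<m} \<and> x = w m" for x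
      proof
        assume a: "fun_upd \<omega> m x = restrict w {0..<Suc m}"
        have "\<omega> i = restrict w {0..<m} i" for i
          using fun_cong[OF a, of i] ext by (cases "i < m") (auto simp: extensional_def)
        moreover have "x = w m" using fun_cong[OF a, of m] by simp
        ultimately show "\<omega> = restrict w {0..<m} \<and> x = w m" by auto
      qed (auto simp: fun_eq_iff)
      have "emeasure (drunk.eP G m \<omega>) {restrict w {0..<Suc m}} =
            emeasure (drunk_kernel G m \<omega>) {x. \<omega> = restrict w {0..<m} \<and> x = w m}"
        using drunk.emeasure_eP[OF \<omega> meas, of G] by (simp add: vimage_def eq)
      also have "\<dots> = ennreal (?q m) * indicator {restrict w {0..<m}} \<omega>"
      proof (cases "\<omega> = restrict w {0..<m}")
        case True
        then have "drunk_kernel G m \<omega> =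
          measure_pmf (case m of 0 \<Rightarrow> pmf_of_set (verts G) | Suc s \<Rightarrow> drunk_step G (w s))"
          by (cases m) (auto simp: drunk_kernel_def)
        with True show ?thesis by (simp add: emeasure_pmf_single)
      qed simp
      finally show "emeasure (drunk.eP G m \<omega>) {restrict w {0..<Suc m}} =
                    ennreal (?q m) * indicator {restrict w {0..<m}} \<omega>" .
    qed
    also have "\<dots> = ennreal (?q m) * ennreal (\<Prod>i<m. ?q i)"
      using meas[of m] by (subst nn_integral_cmult_indicator) (simp_all add: st Suc.IH)
    also have "\<dots> = ennreal (\<Prod>i<Suc m. ?q i)"
      by (simp add: ennreal_mult' mult.commute prod_nonneg)
    finally show ?case .
  qed
  have "{Y. \<forall>i\<le>t. Y i = w i} = drunk.PF.emb UNIV {0..<Suc t} {restrict w {0..<Suc t}}"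
    by (simp add: prod_emb_def space_PiM fun_eq_iff restrict_def less_Suc_eq_le vimage_def)
  then have "emeasure (drunk_walk G) {Y. \<forall>i\<le>t. Y i = w i} =
             emeasure (drunk.CI G {0..<Suc t}) {restrict w {0..<Suc t}}"
    unfolding drunk_walk_def using drunk.lim[OF _ meas] by simp
  also have "\<dots> = emeasure (drunk.C G 0 (Suc t) (\<lambda>_. undefined)) {restrict w {0..<Suc t}}"
  proof -
    have "prod_emb {0..<Suc t} (\<lambda>_. count_space UNIV) {0..<Suc t} {restrict w {0..<Suc t}} =
          {restrict w {0..<Suc t}}"
      by (rule prod_emb_id) (auto simp: space_PiM)
    then show ?thesis using drunk.emeasure_CI[OF order_refl meas, of G] by simp
  qed
  also have "\<dots> = ennreal (\<Prod>i<Suc t. ?q i)" by (rule C)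
  also have "(\<Prod>i<Suc t. ?q i) =
    pmf (pmf_of_set (verts G)) (w 0) * (\<Prod>i<t. pmf (drunk_step G (w i)) (w (Suc i)))"
    by (subst prod.lessThan_Suc_shift) simp
  finally show ?thesis .
qed

text \<open>The product measure makes the robber independent of the cops.\<close>

definition idct_k_from :: "'a graph \<Rightarrow> nat \<Rightarrow> 'a list \<Rightarrow> ennreal" where
  "idct_k_from G k x =
     (INF M\<in>cop_strategies G k x. \<integral>\<^sup>+(X, Y). capture_time X Y \<partial>(M \<Otimes>\<^sub>M drunk_walk G))"

definition idct_k :: "'a graph \<Rightarrow> nat \<Rightarrow> ennreal" where
  "idct_k G k = (INF x\<in>cop_positions G k. idct_k_from G k x)"

definition idct :: "'a graph \<Rightarrow> ennreal" where
  "idct G = idct_k G (cop_number G)"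

definition cost_of_drunkenness_inv :: "'a graph \<Rightarrow> ennreal" where
  "cost_of_drunkenness_inv G = ict G / idct G"

end

theory Submission
  imports Defs "HOL-Real_Asymp.Real_Asymp"
begin

text \<open>
  \<^emph>\<open>Drunk robber, upper bound.\<close> The cop sweeps from \<open>0\<close> to \<open>n - 1\<close>. As long as the robber is free, his
  distance to the cop drops by at least \<open>1\<close> per round in expectation, so from \<open>y\<close> he survives at most \<open>y\<close>
  rounds in expectation, and \<open>y\<close> has mean \<open>(n - 1) / 2\<close>.

  \<^emph>\<open>Drunk robber, lower bound.\<close> Discard half of the initial mass at the two ends. The remaining mass \<open>1 - 1 / n\<close>
  is distributed proportionally to the degree, hence stationary, with flow \<open>1 / (2 n)\<close> along every directed edge
  at all times. In each round but the first, the cop then gains at most \<open>1 / n\<close>: a cop who stays put catches at most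
  the mass \<open>1 / n\<close> that enters his vertex; a cop who moves catches robbers before and after their move, but in
  both cases only those entering his new vertex along the edge he did not come from. So the robber is still free
  after round \<open>t\<close> with probability at least \<open>1 - (t + 3) / n\<close>, and the expected capture time is at least
  \<open>(n - 5) / 2\<close>.

  \<^emph>\<open>Adversarial robber.\<close> The sweep takes at most \<open>n - 1\<close> rounds. Conversely, a robber who waits at one of the ends,
  chosen according to the cop's strategy, survives \<open>n - 1\<close> rounds in expectation.
\<close>


section \<open>The drunk walk as a Markov chain\<close>

lemma sets_drunk_walk [measurable_cong]:
  "sets (drunk_walk G) = sets (PiM UNIV (\<lambda>_. count_space UNIV))"
  by (simp add: drunk_walk_def)

lemma space_drunk_walk [simp]: "space (drunk_walk G) = UNIV"
  by (simp add: drunk_walk_def space_PiM)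

interpretation drunk_walk: prob_space "drunk_walk G" for G
  by (rule prob_space_drunk_walk)

lemma measurable_drunk_walk_component [measurable]:
  "(\<lambda>Y. Y i) \<in> measurable (drunk_walk G) (count_space UNIV)"
  by (simp add: measurable_cong_sets[OF sets_drunk_walk refl])

text \<open>Finite lists over a countable type form a countable discrete space, so questions about
  finitely many rounds become discrete ones.\<close>

lemma measurable_drunk_walk_prefix [measurable]:
  fixes G :: "'a::countable graph"
  shows "(\<lambda>Y. map Y [0..<m]) \<in> measurable (drunk_walk G) (count_space UNIV)"
proof (induction m)
  case (Suc m)
  note [measurable] = Suc
  show ?case by simp
qed simp

lemma emeasure_drunk_walk_Suc:
  "emeasure (drunk_walk G) {Y. \<forall>i\<le>Suc t. Y i = w i} =
   emeasure (drunk_walk G) {Y. \<forall>i\<le>t. Y i = w i} * ennreal (pmf (drunk_step G (w t)) (w (Suc t)))"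
  by (simp only: emeasure_drunk_walk prod.lessThan_Suc)
     (simp add: ennreal_mult prod_nonneg mult.assoc)

text \<open>This is the Markov property on finite histories. Lists are countable, so it suffices to
  compare singletons, where the product formula for cylinder events applies.\<close>

lemma distr_drunk_walk_Suc:
  fixes G :: "'a::countable graph"
  defines "D \<equiv> \<lambda>m. distr (drunk_walk G) (count_space UNIV) (\<lambda>Y. map Y [0..<m])"
  shows "D (Suc (Suc t)) =
    Giry_Monad.bind (D (Suc t))
      (\<lambda>ws. measure_pmf (map_pmf (\<lambda>w. ws @ [w]) (drunk_step G (last ws))))"
    (is "_ = Giry_Monad.bind _ ?K")
proof -
  have K: "?K \<in> measurable (D (Suc t)) (subprob_algebra (count_space UNIV))"
    by (simp add: D_def space_subprob_algebra measure_pmf.subprob_space_axioms)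
  have "emeasure (D (Suc (Suc t))) {ws} = emeasure (Giry_Monad.bind (D (Suc t)) ?K) {ws}" for ws
  proof -
    have prefix: "(\<lambda>Y. map Y [0..<m]) -` {us} = (if length us = m then {Y. \<forall>i<m. Y i = us ! i} else {})"
      for m and us :: "'a list"
    proof -
      have "map Y [0..<m] = us \<longleftrightarrow> length us = m \<and> (\<forall>i<m. Y i = us ! i)" for Y
        by (subst list_eq_iff_nth_eq) auto
      then show ?thesis by auto
    qed
    have D: "emeasure (D m) {us} =
        (if length us = m then emeasure (drunk_walk G) {Y. \<forall>i<m. Y i = us ! i} else 0)" for m us
      unfolding D_def by (subst emeasure_distr) (simp_all add: prefix)
    have bind: "emeasure (Giry_Monad.bind (D (Suc t)) ?K) {ws} = (\<integral>\<^sup>+us. emeasure (?K us) {ws} \<partial>D (Suc t))"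
      using K by (intro emeasure_bind[where N = "count_space UNIV"]) (auto simp: D_def)
    show ?thesis
    proof (cases ws rule: rev_cases)
      case Nil
      have "emeasure (?K us) {ws} = 0" for us
        by (auto simp: Nil emeasure_pmf_single pmf_eq_0_set_pmf)
      then show ?thesis unfolding bind D by (simp add: Nil)
    next
      case (snoc us w)
      \<comment> \<open>The history can be read off the extended list, so the kernel gives mass to
        \<open>ws\<close> only from \<open>us' = us\<close>.\<close>
      have "emeasure (?K us') {ws} = ennreal (pmf (drunk_step G (last us)) w) * indicator {us} us'" for us'
      proof (cases "us' = us")
        case True
        then show ?thesis using pmf_map_inj'[of "\<lambda>w. us @ [w]" "drunk_step G (last us)" w]
          by (simp add: emeasure_pmf_single snoc inj_def)
      next
        case False
        then show ?thesis by (auto simp: emeasure_pmf_single pmf_eq_0_set_pmf snoc)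
      qed
      then have "emeasure (Giry_Monad.bind (D (Suc t)) ?K) {ws} =
          ennreal (pmf (drunk_step G (last us)) w) * emeasure (D (Suc t)) {us}"
        unfolding bind by (simp add: nn_integral_cmult_indicator D_def)
      also have "\<dots> = emeasure (D (Suc (Suc t))) {ws}"
      proof (cases "length us = Suc t")
        case True
        have "{Y. \<forall>i<Suc (Suc t). Y i = ws ! i} = {Y. \<forall>i\<le>Suc t. Y i = ws ! i}"
          "{Y. \<forall>i<Suc t. Y i = us ! i} = {Y. \<forall>i\<le>t. Y i = ws ! i}"
          using True by (auto simp: snoc nth_append less_Suc_eq_le)
        moreover have "ws ! t = last us" "ws ! Suc t = w"
          using True last_conv_nth[of us] by (fastforce simp: snoc nth_append)+
        ultimately show ?thesis
          using emeasure_drunk_walk_Suc[of G t "(!) ws"] by (simp add: D True snoc mult.commute)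
      next
        case False
        then show ?thesis by (simp add: D snoc)
      qed
      finally show ?thesis ..
    qed
  qed
  moreover have "sets (Giry_Monad.bind (D (Suc t)) ?K) = Pow UNIV"
    using sets_bind[of "D (Suc t)" ?K "count_space UNIV"] by (simp add: D_def)
  ultimately show ?thesis
    by (intro measure_eqI_countable[where A = UNIV]) (auto simp: D_def)
qed

text \<open>The working form of the Markov property: the last relevant position may be resampled
  from the previous one. The update \<open>Y(Suc t := w)\<close> keeps integrands as functions of
  whole walks, so that lists disappear from later uses.\<close>

lemma nn_integral_drunk_walk_Suc:
  fixes G :: "'a::countable graph" and F :: "(nat \<Rightarrow> 'a) \<Rightarrow> ennreal"
  assumes F: "\<And>Y Y'. (\<And>i. i \<le> Suc t \<Longrightarrow> Y i = Y' i) \<Longrightarrow> F Y = F Y'"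
  shows "(\<integral>\<^sup>+Y. F Y \<partial>drunk_walk G) =
    (\<integral>\<^sup>+Y. (\<integral>\<^sup>+w. F (Y(Suc t := w)) \<partial>measure_pmf (drunk_step G (Y t))) \<partial>drunk_walk G)"
proof -
  define D where "D = (\<lambda>m. distr (drunk_walk G) (count_space UNIV) (\<lambda>Y. map Y [0..<m]))"
  define f where "f ws = F ((!) ws)" for ws
  let ?K = "\<lambda>ws. measure_pmf (map_pmf (\<lambda>w. ws @ [w]) (drunk_step G (last ws)))"
  have K: "?K \<in> measurable (D (Suc t)) (subprob_algebra (count_space UNIV))"
    by (simp add: D_def space_subprob_algebra measure_pmf.subprob_space_axioms)
  have "(\<integral>\<^sup>+Y. F Y \<partial>drunk_walk G) = (\<integral>\<^sup>+Y. f (map Y [0..<Suc (Suc t)]) \<partial>drunk_walk G)"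
    unfolding f_def by (intro nn_integral_cong F) (simp add: less_Suc_eq_le del: upt_Suc)
  also have "\<dots> = (\<integral>\<^sup>+ws. f ws \<partial>D (Suc (Suc t)))"
    unfolding D_def by (rule nn_integral_distr[symmetric]) simp_all
  also have "\<dots> = (\<integral>\<^sup>+ws. (\<integral>\<^sup>+w. f w \<partial>?K ws) \<partial>D (Suc t))"
    unfolding D_def distr_drunk_walk_Suc
    using K by (intro nn_integral_bind[where B = "count_space UNIV"]) (simp_all add: D_def)
  also have "\<dots> = (\<integral>\<^sup>+Y. (\<integral>\<^sup>+w. f w \<partial>?K (map Y [0..<Suc t])) \<partial>drunk_walk G)"
    unfolding D_def by (rule nn_integral_distr) simp_all
  also have "\<dots> = (\<integral>\<^sup>+Y. (\<integral>\<^sup>+w. F (Y(Suc t := w)) \<partial>measure_pmf (drunk_step G (Y t))) \<partial>drunk_walk G)"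
  proof (intro nn_integral_cong)
    fix Y
    have "f (map Y [0..<Suc t] @ [w]) = F (Y(Suc t := w))" for w
      unfolding f_def by (rule F) (auto simp: nth_append less_Suc_eq_le le_Suc_eq simp del: upt_Suc)
    then show "(\<integral>\<^sup>+w. f w \<partial>?K (map Y [0..<Suc t])) =
      (\<integral>\<^sup>+w. F (Y(Suc t := w)) \<partial>measure_pmf (drunk_step G (Y t)))"
      by simp
  qed
  finally show ?thesis .
qed

lemma nn_integral_drunk_walk_0:
  fixes G :: "'a::countable graph" and f :: "'a \<Rightarrow> ennreal"
  shows "(\<integral>\<^sup>+Y. f (Y 0) \<partial>drunk_walk G) = (\<integral>\<^sup>+v. f v \<partial>measure_pmf (pmf_of_set (verts G)))"
proof -
  have "distr (drunk_walk G) (count_space UNIV) (\<lambda>Y. Y 0) = measure_pmf (pmf_of_set (verts G))"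
  proof (rule measure_eqI_countable[where A = UNIV])
    fix v :: 'a
    have "(\<lambda>Y. Y 0) -` {v} = {Y. \<forall>i\<le>0::nat. Y i = v}" by auto
    then show "emeasure (distr (drunk_walk G) (count_space UNIV) (\<lambda>Y. Y 0)) {v} =
      emeasure (measure_pmf (pmf_of_set (verts G))) {v}"
      using emeasure_drunk_walk[of G 0 "\<lambda>_. v"]
      by (simp add: emeasure_distr emeasure_pmf_single)
  qed auto
  then have "(\<integral>\<^sup>+v. f v \<partial>measure_pmf (pmf_of_set (verts G))) =
    (\<integral>\<^sup>+v. f v \<partial>distr (drunk_walk G) (count_space UNIV) (\<lambda>Y. Y 0))" by simp
  then show ?thesis by (simp add: nn_integral_distr)
qed

text \<open>The degree-weighted uniform start is stationary: it is proportional to the reversible measure of the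
  walk, so that every edge carries the same flow at every time.\<close>

lemma nn_integral_drunk_walk_edge:
  fixes G :: "'a::countable graph"
  assumes "finite (neighbours G v)"
    and vertex: "(\<integral>\<^sup>+Y. of_nat (card (neighbours G (Y 0))) * indicator {v} (Y s) \<partial>drunk_walk G) =
      ennreal (real (card (neighbours G v)) / c)"
    and "c > 0"
  shows "(\<integral>\<^sup>+Y. of_nat (card (neighbours G (Y 0))) * indicator {v} (Y s) * indicator {w} (Y (Suc s))
    \<partial>drunk_walk G) = (if w \<in> neighbours G v then ennreal (1 / c) else 0)"
proof -
  let ?d = "\<lambda>Y. of_nat (card (neighbours G (Y 0))) :: ennreal"
  let ?p = "\<lambda>v. ennreal (pmf (drunk_step G v) w)"
  have "(\<integral>\<^sup>+Y. ?d Y * indicator {v} (Y s) * indicator {w} (Y (Suc s)) \<partial>drunk_walk G) =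
    (\<integral>\<^sup>+Y. (\<integral>\<^sup>+u. ?d Y * indicator {v} (Y s) * indicator {w} u \<partial>drunk_step G (Y s)) \<partial>drunk_walk G)"
    by (subst nn_integral_drunk_walk_Suc[where t = s]) auto
  also have "\<dots> = (\<integral>\<^sup>+Y. ?d Y * indicator {v} (Y s) * ?p v \<partial>drunk_walk G)"
    by (intro nn_integral_cong) (auto simp: nn_integral_cmult emeasure_pmf_single split: split_indicator)
  also have "\<dots> = ennreal (real (card (neighbours G v)) / c) * ?p v"
    by (subst nn_integral_multc) (simp_all add: vertex)
  also have "\<dots> = (if w \<in> neighbours G v then ennreal (1 / c) else 0)"
  proof (cases "neighbours G v = {}")
    case False
    then have "real (card (neighbours G v)) > 0" using assms by (simp add: card_gt_0_iff)
    then show ?thesis using assms False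
      by (simp add: drunk_step_def pmf_of_set ennreal_mult'[symmetric] indicator_def)
  qed simp
  finally show ?thesis .
qed

text \<open>Induction on \<open>s\<close>: if every vertex carries its degree divided by the number
  of vertices, then each of its edges carries the same flow, and \<open>w\<close> receives this flow
  once from each of its neighbours.\<close>

lemma nn_integral_drunk_walk_vertex:
  fixes G :: "'a::countable graph"
  assumes fin: "finite (verts G)"
    and nb: "\<And>v. neighbours G v \<subseteq> verts G"
    and pos: "\<And>v. v \<in> verts G \<Longrightarrow> neighbours G v \<noteq> {}"
    and "v \<in> verts G"
  shows "(\<integral>\<^sup>+Y. of_nat (card (neighbours G (Y 0))) * indicator {v} (Y s) \<partial>drunk_walk G) =
      ennreal (real (card (neighbours G v)) / card (verts G))"
  using \<open>v \<in> verts G\<close>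
proof (induction s arbitrary: v)
  case 0
  then have "verts G \<noteq> {}" by blast
  have "(\<integral>\<^sup>+Y. of_nat (card (neighbours G (Y 0))) * indicator {v} (Y 0) \<partial>drunk_walk G) =
    (\<integral>\<^sup>+u. of_nat (card (neighbours G u)) * indicator {v} u \<partial>measure_pmf (pmf_of_set (verts G)))"
    by (rule nn_integral_drunk_walk_0)
  also have "\<dots> = (\<integral>\<^sup>+u. of_nat (card (neighbours G v)) * indicator {v} u \<partial>measure_pmf (pmf_of_set (verts G)))"
    by (intro nn_integral_cong) (simp split: split_indicator)
  also have "\<dots> = ennreal (real (card (neighbours G v)) / card (verts G))"
    using pmf_of_set[OF \<open>verts G \<noteq> {}\<close> fin, of v] 0 by (subst nn_integral_cmult_indicator)
      (auto simp: emeasure_pmf_single divide_inverse ennreal_of_nat_eq_real_of_nat ennreal_mult'[symmetric])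
  finally show ?case .
next
  case (Suc s w)
  let ?d = "\<lambda>Y. of_nat (card (neighbours G (Y 0))) :: ennreal"
  let ?p = "\<lambda>v. ennreal (pmf (drunk_step G v) w)"
  let ?n = "real (card (verts G))"
  have fin_nb: "finite (neighbours G v)" for v using fin nb[of v] by (rule rev_finite_subset)
  have c: "?n > 0" using fin Suc.prems by (auto simp: card_gt_0_iff)
  have sym: "w \<in> neighbours G v \<longleftrightarrow> v \<in> neighbours G w" for v
    by (simp add: neighbours_def insert_commute)
  \<comment> \<open>As \<open>w\<close> is not isolated, a step to \<open>w\<close> can only come
    from a neighbour of \<open>w\<close>, so conditioning on the previous vertex gives a finite
    sum.\<close>
  have p_split: "?p u = (\<Sum>v\<in>neighbours G w. indicator {v} u * ?p v)" for u
  proof -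
    have "?p u = 0" if "u \<notin> neighbours G w"
      using that pos[OF Suc.prems] fin_nb by (auto simp: drunk_step_def sym[of u, symmetric] indicator_def split: if_splits)
    then have "?p u = (\<Sum>v\<in>neighbours G w. if v = u then ?p u else 0)"
      using fin_nb by simp
    also have "\<dots> = (\<Sum>v\<in>neighbours G w. indicator {v} u * ?p v)"
      by (intro sum.cong) (auto simp: indicator_def)
    finally show ?thesis .
  qed
  have "(\<integral>\<^sup>+Y. ?d Y * indicator {w} (Y (Suc s)) \<partial>drunk_walk G) =
    (\<integral>\<^sup>+Y. (\<integral>\<^sup>+u. ?d Y * indicator {w} u \<partial>drunk_step G (Y s)) \<partial>drunk_walk G)"
    by (subst nn_integral_drunk_walk_Suc[where t = s]) auto
  also have "\<dots> = (\<integral>\<^sup>+Y. ?d Y * ?p (Y s) \<partial>drunk_walk G)"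
    by (intro nn_integral_cong) (auto simp: nn_integral_cmult emeasure_pmf_single)
  also have "\<dots> = (\<integral>\<^sup>+Y. (\<Sum>v\<in>neighbours G w. ?d Y * indicator {v} (Y s) * ?p v) \<partial>drunk_walk G)"
    by (subst p_split) (simp add: sum_distrib_left mult.assoc)
  also have "\<dots> = (\<Sum>v\<in>neighbours G w. (\<integral>\<^sup>+Y. ?d Y * indicator {v} (Y s) \<partial>drunk_walk G) * ?p v)"
    by (simp add: nn_integral_sum nn_integral_multc)
  also have "\<dots> = (\<Sum>v\<in>neighbours G w. ennreal (1 / ?n))"
  proof (rule sum.cong)
    fix v assume v: "v \<in> neighbours G w"
    then have "v \<in> verts G" using nb by blast
    moreover have "neighbours G v \<noteq> {}" "w \<in> neighbours G v" using v sym[of v] by auto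
    moreover have "real (card (neighbours G v)) > 0" using fin_nb calculation by (simp add: card_gt_0_iff)
    ultimately show "(\<integral>\<^sup>+Y. ?d Y * indicator {v} (Y s) \<partial>drunk_walk G) * ?p v = ennreal (1 / ?n)"
      using fin_nb Suc.IH[of v] by (simp add: drunk_step_def pmf_of_set ennreal_mult'[symmetric])
  qed simp
  also have "\<dots> = ennreal (real (card (neighbours G w)) / ?n)"
    using c by (simp add: ennreal_of_nat_eq_real_of_nat ennreal_mult'[symmetric])
  finally show ?case .
qed


section \<open>Paths and capture times\<close>

lemma neighbours_path_graph:
  "neighbours (path_graph n) v = {u. u < n \<and> v < n \<and> (u = Suc v \<or> v = Suc u)}"
proof (intro set_eqI iffI)
  fix u assume "u \<in> neighbours (path_graph n) v"
  then show "u \<in> {u. u < n \<and> v < n \<and> (u = Suc v \<or> v = Suc u)}"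
    by (auto simp: neighbours_def path_graph_def doubleton_eq_iff)
next
  fix u assume u: "u \<in> {u. u < n \<and> v < n \<and> (u = Suc v \<or> v = Suc u)}"
  \<comment> \<open>\<open>path_graph\<close> indexes an edge by its larger endpoint, so
    \<open>max u v\<close> is the witness.\<close>
  then have "{v, u} = {max u v - 1, max u v}" "1 \<le> max u v" "max u v < n" by auto
  then show "u \<in> neighbours (path_graph n) v"
    unfolding neighbours_def path_graph_def by auto
qed

text \<open>Each end lacks one neighbour. Stating the deficit additively avoids truncated
  subtraction and makes the degrees easy to sum.\<close>

lemma card_neighbours_path_graph:
  assumes "n \<ge> 2" "v < n"
  shows "card (neighbours (path_graph n) v) + (if v = 0 then 1 else 0) + (if v = n - 1 then 1 else 0) = 2"
proof -
  consider "v = 0" | "v = n - 1" "v \<noteq> 0" | "0 < v" "v < n - 1" using assms by linarith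
  then show ?thesis
  proof cases
    case 1
    then have "neighbours (path_graph n) v = {1}" using assms by (auto simp: neighbours_path_graph)
    then show ?thesis using 1 assms by simp
  next
    case 2
    then have "neighbours (path_graph n) v = {n - 2}" using assms by (auto simp: neighbours_path_graph)
    then show ?thesis using 2 assms by simp
  next
    case 3
    then have "neighbours (path_graph n) v = {v - 1, Suc v}" by (auto simp: neighbours_path_graph)
    then show ?thesis using 3 by simp
  qed
qed

lemma verts_path_graph [simp]: "verts (path_graph n) = {..<n}"
  by (auto simp: path_graph_def)

lemma finite_neighbours_path_graph [simp]: "finite (neighbours (path_graph n) v)"
  by (rule finite_subset[of _ "{..<n}"]) (auto simp: neighbours_path_graph)

lemma move_path_graph:
  "u < n \<Longrightarrow> move (path_graph n) u v \<longleftrightarrow> v < n \<and> (v = u \<or> v = Suc u \<or> u = Suc v)"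
  by (auto simp: move_def neighbours_path_graph)

lemma capture_time_Least:
  assumes "captured X Y t"
  shows "capture_time X Y = of_nat (LEAST t. captured X Y t)"
  unfolding capture_time_def
proof (rule antisym)
  show "(INF t\<in>{t. captured X Y t}. of_nat t) \<le> (of_nat (LEAST t. captured X Y t) :: ennreal)"
    using LeastI[of "captured X Y", OF assms] by (intro INF_lower) auto
  show "(of_nat (LEAST t. captured X Y t) :: ennreal) \<le> (INF t\<in>{t. captured X Y t}. of_nat t)"
    by (intro INF_greatest) (auto simp: Least_le)
qed

lemma capture_time_eq_top: "(\<And>t. \<not> captured X Y t) \<Longrightarrow> capture_time X Y = top"
  by (simp add: capture_time_def)

text \<open>The tail-sum formula: the summand at \<open>t\<close> is 1 exactly when the capture time
  exceeds \<open>t\<close>. Truncation at \<open>m\<close> keeps the sum finite even for a robber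
  who is never caught.\<close>

lemma sum_not_captured:
  "(\<Sum>t<m. indicator {Y. \<forall>s\<le>t. \<not> captured X Y s} Y) = min (capture_time X Y) (of_nat m)"
proof -
  have "(\<Sum>t<m. indicator {Y. \<forall>s\<le>t. \<not> captured X Y s} Y) =
      (of_nat (card {t. t < m \<and> (\<forall>s\<le>t. \<not> captured X Y s)}) :: ennreal)"
    by (simp add: indicator_def Int_def)
  also have "\<dots> = min (capture_time X Y) (of_nat m)"
  proof (cases "\<exists>t. captured X Y t")
    case True
    then obtain t where t: "captured X Y t" by blast
    define T where "T = (LEAST t. captured X Y t)"
    have "captured X Y T" unfolding T_def using t by (rule LeastI)
    then have "(\<forall>s\<le>t. \<not> captured X Y s) \<longleftrightarrow> t < T" for t
      using not_less_Least[of _ "captured X Y"] unfolding T_def by (metis le_less_trans not_le)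
    then have "{t. t < m \<and> (\<forall>s\<le>t. \<not> captured X Y s)} = {t. t < m \<and> t < T}" by simp
    also have "\<dots> = {..<min T m}" by auto
    finally have "{t. t < m \<and> (\<forall>s\<le>t. \<not> captured X Y s)} = {..<min T m}" .
    then show ?thesis by (simp add: capture_time_Least[OF t] T_def[symmetric] min_def)
  next
    case False
    then show ?thesis by (simp add: capture_time_eq_top)
  qed
  finally show ?thesis .
qed

text \<open>Such an event is the preimage of a set of lists under the prefix map, and every set of
  lists is measurable. One implication suffices as hypothesis because \<open>Y\<close> and
  \<open>Y'\<close> can be exchanged.\<close>

lemma sets_drunk_walk_prefix:
  fixes G :: "'a::countable graph"
  assumes "\<And>Y Y'. (\<And>i. i < m \<Longrightarrow> Y i = Y' i) \<Longrightarrow> P Y \<Longrightarrow> P Y'"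
  shows "{Y. P Y} \<in> sets (drunk_walk G)"
proof -
  have "P Y \<longleftrightarrow> P ((!) (map Y [0..<m]))" for Y
  proof
    assume "P Y"
    then show "P ((!) (map Y [0..<m]))" by (rule assms[rotated]) simp
  next
    assume "P ((!) (map Y [0..<m]))"
    then show "P Y" by (rule assms[rotated]) simp
  qed
  then have "{Y. P Y} = (\<lambda>Y. map Y [0..<m]) -` {ws. P ((!) ws)} \<inter> space (drunk_walk G)"
    by (simp add: vimage_def)
  also have "\<dots> \<in> sets (drunk_walk G)"
    by (rule measurable_sets[OF measurable_drunk_walk_prefix]) simp
  finally show ?thesis .
qed

section \<open>The degree-weighted walk on the path\<close>

text \<open>On the path, half of this measure is what remains of the drunk walk after the discarding
  at the ends. It is left unnormalised, so that vertices carry degree over \<open>n\<close> and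
  directed edges carry \<open>1 / n\<close>.\<close>

definition degree_walk :: "'a graph \<Rightarrow> (nat \<Rightarrow> 'a) measure" where
  "degree_walk G = density (drunk_walk G) (\<lambda>Y. of_nat (card (neighbours G (Y 0))))"

lemma sets_degree_walk [simp]: "sets (degree_walk G) = sets (drunk_walk G)"
  by (simp add: degree_walk_def)

lemma space_degree_walk [simp]: "space (degree_walk G) = UNIV"
  by (simp add: degree_walk_def)

lemma emeasure_degree_walk:
  "A \<in> sets (drunk_walk G) \<Longrightarrow>
    emeasure (degree_walk G) A = (\<integral>\<^sup>+Y. of_nat (card (neighbours G (Y 0))) * indicator A Y \<partial>drunk_walk G)"
  unfolding degree_walk_def
  by (rule emeasure_density)
    (auto intro: measurable_compose[OF measurable_drunk_walk_component] simp: ennreal_of_nat_eq_real_of_nat)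

lemma nonempty_neighbours_path_graph: "n \<ge> 2 \<Longrightarrow> v < n \<Longrightarrow> neighbours (path_graph n) v \<noteq> {}"
  using card_neighbours_path_graph[of n v] by (auto split: if_splits)

lemma neighbours_path_graph_subset: "neighbours (path_graph n) v \<subseteq> verts (path_graph n)"
  by (auto simp: neighbours_path_graph)

lemma card_neighbours_path_graph_le:
  assumes "n \<ge> 2"
  shows "card (neighbours (path_graph n) v) \<le> 2"
proof (cases "v < n")
  case True
  then show ?thesis using card_neighbours_path_graph[of n v] assms by simp
next
  case False
  then have "neighbours (path_graph n) v = {}" by (auto simp: neighbours_path_graph)
  then show ?thesis by simp
qed

text \<open>The density is a degree, hence at most 2. Through this bound, estimates for the
  stationary flow pass back to the drunk walk.\<close>

lemma emeasure_degree_walk_path_le: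
  assumes "n \<ge> 2" "A \<in> sets (drunk_walk (path_graph n))"
  shows "emeasure (degree_walk (path_graph n)) A \<le> 2 * emeasure (drunk_walk (path_graph n)) A"
proof -
  have "emeasure (degree_walk (path_graph n)) A \<le> (\<integral>\<^sup>+Y. 2 * indicator A Y \<partial>drunk_walk (path_graph n))"
    unfolding emeasure_degree_walk[OF assms(2)]
    using card_neighbours_path_graph_le[OF assms(1)] of_nat_mono[of _ 2, where 'a = ennreal]
    by (intro nn_integral_mono mult_right_mono) auto
  then show ?thesis using assms(2) by (simp add: nn_integral_cmult_indicator)
qed

lemma finite_measure_degree_walk_path:
  assumes "n \<ge> 2"
  shows "finite_measure (degree_walk (path_graph n))"
proof
  have "emeasure (degree_walk (path_graph n)) UNIV \<le> 2 * emeasure (drunk_walk (path_graph n)) UNIV"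
    using sets.top[of "drunk_walk (path_graph n)"] by (intro emeasure_degree_walk_path_le assms) simp
  also have "\<dots> = 2"
    using drunk_walk.emeasure_space_1[of "path_graph n"] by simp
  finally show "emeasure (degree_walk (path_graph n)) (space (degree_walk (path_graph n))) \<noteq> \<infinity>"
    by (auto simp: top_unique)
qed

lemma measure_degree_walk_path_le:
  assumes "n \<ge> 2" "A \<in> sets (drunk_walk (path_graph n))"
  shows "measure (degree_walk (path_graph n)) A \<le> 2 * measure (drunk_walk (path_graph n)) A"
proof -
  interpret \<nu>: finite_measure "degree_walk (path_graph n)"
    by (rule finite_measure_degree_walk_path[OF assms(1)])
  show ?thesis
    using emeasure_degree_walk_path_le[OF assms]
    by (simp add: \<nu>.emeasure_eq_measure drunk_walk.emeasure_eq_measure ennreal_mult'[symmetric]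
        flip: ennreal_numeral)
qed

lemma measure_degree_walk_path_UNIV:
  assumes n: "n \<ge> 2"
  shows "measure (degree_walk (path_graph n)) UNIV = 2 - 2 / real n"
proof -
  let ?d = "\<lambda>v. card (neighbours (path_graph n) v)"
  have "(\<Sum>v<n. ?d v + (if v = 0 then 1 else 0) + (if v = n - 1 then 1 else 0)) = (\<Sum>v<n. 2)"
    using card_neighbours_path_graph[OF n] by (intro sum.cong) auto
  then have sum: "(\<Sum>v<n. ?d v) = 2 * n - 2"
    using n by (simp add: sum.distrib)
  have "emeasure (degree_walk (path_graph n)) UNIV = (\<integral>\<^sup>+Y. of_nat (?d (Y 0)) \<partial>drunk_walk (path_graph n))"
    using sets.top[of "drunk_walk (path_graph n)"] by (subst emeasure_degree_walk) auto
  also have "\<dots> = (\<integral>\<^sup>+v. of_nat (?d v) \<partial>measure_pmf (pmf_of_set {..<n}))"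
    using nn_integral_drunk_walk_0[of "path_graph n" "\<lambda>v. of_nat (?d v)"] by simp
  also have "\<dots> = of_nat (\<Sum>v<n. ?d v) / of_nat n"
    using n by (subst nn_integral_pmf_of_set) (auto simp: lessThan_empty_iff)
  also have "\<dots> = ennreal (2 - 2 / real n)"
    unfolding sum using n
    by (simp add: ennreal_of_nat_eq_real_of_nat divide_ennreal of_nat_diff field_simps)
  finally show ?thesis using n by (simp add: measure_def field_simps)
qed

lemma sets_walk_event:
  fixes G :: "'a::countable graph"
  shows "{Y. P (Y i) (Y j)} \<in> sets (drunk_walk G)"
  by (rule sets_drunk_walk_prefix[of "Suc (max i j)"]) (simp add: less_Suc_eq_le)

lemma measure_degree_walk_path_vertex:
  assumes n: "n \<ge> 2" and v: "v < n"
  shows "measure (degree_walk (path_graph n)) {Y. Y s = v} = card (neighbours (path_graph n) v) / n"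
proof -
  have "emeasure (degree_walk (path_graph n)) {Y. Y s = v} =
    (\<integral>\<^sup>+Y. of_nat (card (neighbours (path_graph n) (Y 0))) * indicator {v} (Y s) \<partial>drunk_walk (path_graph n))"
    using sets_walk_event[of "\<lambda>a b. a = v" s s]
    by (subst emeasure_degree_walk) (auto intro!: nn_integral_cong simp: indicator_def)
  also have "\<dots> = ennreal (card (neighbours (path_graph n) v) / n)"
    using nn_integral_drunk_walk_vertex[of "path_graph n" v s] v
      neighbours_path_graph_subset nonempty_neighbours_path_graph[OF n] by simp
  finally show ?thesis by (simp add: measure_def)
qed

lemma measure_degree_walk_path_edge:
  assumes n: "n \<ge> 2" and v: "v < n" and w: "w \<in> neighbours (path_graph n) v"
  shows "measure (degree_walk (path_graph n)) {Y. Y s = v \<and> Y (Suc s) = w} = 1 / n"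
proof -
  have "emeasure (degree_walk (path_graph n)) {Y. Y s = v \<and> Y (Suc s) = w} =
    (\<integral>\<^sup>+Y. of_nat (card (neighbours (path_graph n) (Y 0))) * indicator {v} (Y s) * indicator {w} (Y (Suc s))
      \<partial>drunk_walk (path_graph n))"
    using sets_walk_event[of "\<lambda>a b. a = v \<and> b = w" s "Suc s"]
    by (subst emeasure_degree_walk) (auto intro!: nn_integral_cong simp: indicator_def)
  also have "\<dots> = ennreal (1 / n)"
    using nn_integral_drunk_walk_edge[of "path_graph n" v s n w]
      nn_integral_drunk_walk_vertex[of "path_graph n" v s] v w n
      neighbours_path_graph_subset nonempty_neighbours_path_graph[OF n] by simp
  finally show ?thesis by (simp add: measure_def)
qed

text \<open>A cop who moves from \<open>v\<close> to \<open>w\<close> can catch at \<open>w\<close> only a robber who does not come from \<open>v\<close>, as he has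
  already searched \<open>v\<close>. This halves the chance of each of the two kinds of capture, before and after the
  robber's move.\<close>

lemma measure_degree_walk_path_enter:
  assumes n: "n \<ge> 2" and v: "v < n" and w: "w \<in> neighbours (path_graph n) v"
  shows "measure (degree_walk (path_graph n)) {Y. Y s \<noteq> v \<and> Y (Suc s) = w} \<le> 1 / n"
proof -
  interpret \<nu>: finite_measure "degree_walk (path_graph n)"
    by (rule finite_measure_degree_walk_path[OF n])
  have "w < n" using w by (simp add: neighbours_path_graph)
  \<comment> \<open>The total flow into \<open>w\<close> is at most \<open>2 / n\<close>, and
    exactly \<open>1 / n\<close> of it comes from \<open>v\<close>.\<close>
  have "measure (degree_walk (path_graph n)) ({Y. Y (Suc s) = w} - {Y. Y s = v \<and> Y (Suc s) = w}) =
    card (neighbours (path_graph n) w) / n - 1 / n"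
    using sets_walk_event[of "\<lambda>a b. a = v \<and> b = w" s "Suc s"] sets_walk_event[of "\<lambda>a b. b = w" s "Suc s"]
    by (subst \<nu>.finite_measure_Diff)
       (auto simp: measure_degree_walk_path_vertex[OF n \<open>w < n\<close>] measure_degree_walk_path_edge[OF n v w])
  also have "\<dots> \<le> 2 / n - 1 / n"
    using of_nat_mono[OF card_neighbours_path_graph_le[OF n, of w], where 'a = real]
    by (intro diff_right_mono divide_right_mono) simp_all
  also have "{Y. Y (Suc s) = w} - {Y. Y s = v \<and> Y (Suc s) = w} = {Y. Y s \<noteq> v \<and> Y (Suc s) = w}"
    by auto
  finally show ?thesis using n by (simp add: field_simps)
qed


section \<open>Lower bound against the drunk robber\<close>

lemma captured_single:
  "captured (\<lambda>t. [c t]) Y s \<longleftrightarrow> Y s = c s \<or> (\<exists>r. s = Suc r \<and> Y r = c s)"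
  unfolding captured_def by (cases s) auto

lemma captured_cong:
  "(\<And>i. i \<le> s \<Longrightarrow> Y i = Y' i) \<Longrightarrow> captured X Y s \<longleftrightarrow> captured X Y' s"
  by (auto simp: captured_def)

lemma sets_captured:
  fixes G :: "'a::countable graph"
  shows "{Y. \<exists>s\<le>t. captured X Y s} \<in> sets (drunk_walk G)"
    and "{Y. \<forall>s\<le>t. \<not> captured X Y s} \<in> sets (drunk_walk G)"
proof -
  show "{Y. \<exists>s\<le>t. captured X Y s} \<in> sets (drunk_walk G)"
  proof (rule sets_drunk_walk_prefix[of "Suc t"])
    fix Y Y' assume "\<And>i. i < Suc t \<Longrightarrow> Y i = Y' i" and "\<exists>s\<le>t. captured X Y s"
    then show "\<exists>s\<le>t. captured X Y' s" using captured_cong[of _ Y Y' X] by (metis le_imp_less_Suc le_trans)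
  qed
  show "{Y. \<forall>s\<le>t. \<not> captured X Y s} \<in> sets (drunk_walk G)"
  proof (rule sets_drunk_walk_prefix[of "Suc t"])
    fix Y Y' assume "\<And>i. i < Suc t \<Longrightarrow> Y i = Y' i" and "\<forall>s\<le>t. \<not> captured X Y s"
    then show "\<forall>s\<le>t. \<not> captured X Y' s" using captured_cong[of _ Y Y' X] by (metis le_imp_less_Suc le_trans)
  qed
qed

text \<open>Round 0 costs at most the mass \<open>2 / n\<close> of one vertex. Round 1 may cost
  twice that, since no earlier robber move restricts where he came from. Every later round adds at
  most \<open>2 / n\<close>. The offset in \<open>t + 2\<close> is fitted to round 1.\<close>

lemma measure_degree_walk_captured:
  assumes n: "n \<ge> 2" and c0: "c 0 < n" and c: "\<And>t. move (path_graph n) (c t) (c (Suc t))"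
  shows "measure (degree_walk (path_graph n)) {Y. \<exists>s\<le>t. captured (\<lambda>t. [c t]) Y s} \<le> 2 * (real t + 2) / n"
proof -
  define \<nu> where "\<nu> = measure (degree_walk (path_graph n))"
  define C where "C t = {Y. \<exists>s\<le>t. captured (\<lambda>t. [c t]) Y s}" for t
  interpret \<nu>: finite_measure "degree_walk (path_graph n)"
    by (rule finite_measure_degree_walk_path[OF n])
  have lt: "c t < n" for t
  proof (induction t)
    case (Suc t)
    then show ?case using c[of t] by (simp add: move_path_graph)
  qed (rule c0)
  have vertex: "\<nu> {Y. Y s = c t} \<le> 2 / n" for s t
    unfolding \<nu>_def measure_degree_walk_path_vertex[OF n lt]
    using of_nat_mono[OF card_neighbours_path_graph_le[OF n, of "c t"], where 'a = real]
    by (intro divide_right_mono) simp_all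
  have union: "\<nu> A \<le> \<nu> B + \<nu> B'"
    if "A \<subseteq> B \<union> B'" "B \<in> sets (drunk_walk (path_graph n))" "B' \<in> sets (drunk_walk (path_graph n))" for A B B'
    using \<nu>.finite_measure_mono[OF that(1)] measure_Un_le[of B "degree_walk (path_graph n)" B'] that
    by (simp add: \<nu>_def)
  have [simp]: "{Y. Y i = w} \<in> sets (drunk_walk (path_graph n))"
    "{Y. Y i \<noteq> v \<and> Y j = w} \<in> sets (drunk_walk (path_graph n))"
    "{Y. Y i = v \<or> Y j = w} \<in> sets (drunk_walk (path_graph n))" for i j v w
    using sets_walk_event[of "\<lambda>a b. a = w" i i] sets_walk_event[of "\<lambda>a b. a \<noteq> v \<and> b = w" i j]
      sets_walk_event[of "\<lambda>a b. a = v \<or> b = w" i j] by simp_all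
  have [simp]: "C t \<in> sets (drunk_walk (path_graph n))" for t
    unfolding C_def by (rule sets_captured)
  have C_0: "\<nu> (C 0) \<le> 2 / n"
    using vertex[of 0 0] by (simp add: C_def captured_single)
  have C_Suc_0: "\<nu> (C (Suc 0)) \<le> 6 / n"
  proof -
    have "C (Suc 0) \<subseteq> C 0 \<union> {Y. Y 0 = c 1 \<or> Y 1 = c 1}"
      by (auto simp: C_def captured_single le_Suc_eq)
    then have "\<nu> (C (Suc 0)) \<le> \<nu> (C 0) + \<nu> {Y. Y 0 = c 1 \<or> Y 1 = c 1}"
      by (rule union) simp_all
    also have "\<nu> {Y. Y 0 = c 1 \<or> Y 1 = c 1} \<le> \<nu> {Y. Y 0 = c 1} + \<nu> {Y. Y 1 = c 1}"
      by (rule union) (auto simp del: One_nat_def)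
    finally show ?thesis using vertex[of 0 1] vertex[of 1 1] C_0 by simp
  qed
  have C_Suc_Suc: "\<nu> (C (Suc (Suc r))) \<le> \<nu> (C (Suc r)) + 2 / n" for r
  proof (cases "c (Suc (Suc r)) = c (Suc r)")
    case True
    \<comment> \<open>A robber at the waiting cop's vertex before his own move was already caught in
      the previous round, so only arrivals after the move are new.\<close>
    have "C (Suc (Suc r)) \<subseteq> C (Suc r) \<union> {Y. Y (Suc (Suc r)) = c (Suc (Suc r))}"
      using True by (auto simp: C_def captured_single le_Suc_eq)
    then have "\<nu> (C (Suc (Suc r))) \<le> \<nu> (C (Suc r)) + \<nu> {Y. Y (Suc (Suc r)) = c (Suc (Suc r))}"
      by (rule union) simp_all
    then show ?thesis using vertex[of "Suc (Suc r)" "Suc (Suc r)"] by simp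
  next
    case False
    then have nb: "c (Suc (Suc r)) \<in> neighbours (path_graph n) (c (Suc r))"
      using c[of "Suc r"] by (auto simp: move_def)
    let ?A = "\<lambda>i. {Y. Y i \<noteq> c (Suc r) \<and> Y (Suc i) = c (Suc (Suc r))}"
    \<comment> \<open>\<open>?A r\<close> is a capture by the cop's move, \<open>?A (Suc r)\<close>
      one by the robber's. Freedom after round \<open>Suc r\<close> keeps the robber off
      \<open>c (Suc r)\<close> both before and after his move in that round, which gives the first
      condition in each set.\<close>
    have "C (Suc (Suc r)) \<subseteq> C (Suc r) \<union> (?A r \<union> ?A (Suc r))"
    proof
      fix Y assume Y: "Y \<in> C (Suc (Suc r))"
      show "Y \<in> C (Suc r) \<union> (?A r \<union> ?A (Suc r))"
      proof (cases "Y \<in> C (Suc r)")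
        case False
        then have "Y r \<noteq> c (Suc r)" "Y (Suc r) \<noteq> c (Suc r)" by (auto simp: C_def captured_single)
        moreover have "Y (Suc (Suc r)) = c (Suc (Suc r)) \<or> Y (Suc r) = c (Suc (Suc r))"
          using Y False by (auto simp: C_def captured_single le_Suc_eq)
        ultimately show ?thesis by blast
      qed simp
    qed
    then have "\<nu> (C (Suc (Suc r))) \<le> \<nu> (C (Suc r)) + \<nu> (?A r \<union> ?A (Suc r))"
      by (rule union) (auto intro!: sets.Un)
    also have "\<nu> (?A r \<union> ?A (Suc r)) \<le> \<nu> (?A r) + \<nu> (?A (Suc r))"
      by (rule union) simp_all
    also have "\<nu> (?A r) + \<nu> (?A (Suc r)) \<le> 1 / n + 1 / n"
      unfolding \<nu>_def by (intro add_mono measure_degree_walk_path_enter[OF n lt nb])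
    finally show ?thesis by simp
  qed
  have "\<nu> (C t) \<le> 2 * (real t + 2) / n"
  proof (induction t)
    case 0
    then show ?case using C_0 n by (simp add: field_simps)
  next
    case (Suc t)
    show ?case
    proof (cases t)
      case 0
      then show ?thesis using C_Suc_0 n by (simp add: field_simps)
    next
      case (Suc r)
      then show ?thesis using C_Suc_Suc[of r] Suc.IH n by (simp add: field_simps)
    qed
  qed
  then show ?thesis by (simp add: \<nu>_def C_def)
qed

text \<open>The survival probability decreases at most linearly, from about 1 to 0 over about
  \<open>n\<close> rounds, so the tail sum is at least the area of a triangle, about
  \<open>n / 2\<close>.\<close>

lemma nn_integral_capture_time_path_ge:
  assumes n: "n \<ge> 2" and c0: "c 0 < n" and c: "\<And>t. move (path_graph n) (c t) (c (Suc t))"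
  shows "ennreal ((real n - 5) / 2) \<le> (\<integral>\<^sup>+Y. capture_time (\<lambda>t. [c t]) Y \<partial>drunk_walk (path_graph n))"
proof -
  interpret \<nu>: finite_measure "degree_walk (path_graph n)"
    by (rule finite_measure_degree_walk_path[OF n])
  let ?X = "\<lambda>t. [c t]"
  let ?U = "\<lambda>t. {Y. \<forall>s\<le>t. \<not> captured ?X Y s}" and ?C = "\<lambda>t. {Y. \<exists>s\<le>t. captured ?X Y s}"
  have U: "1 - (real t + 3) / n \<le> measure (drunk_walk (path_graph n)) (?U t)" for t
  proof -
    have "?U t = UNIV - ?C t" by auto
    then have "measure (degree_walk (path_graph n)) (?U t) =
        2 - 2 / real n - measure (degree_walk (path_graph n)) (?C t)"
      using sets_captured[of t ?X "path_graph n"]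
      by (simp add: \<nu>.finite_measure_compl[simplified] measure_degree_walk_path_UNIV[OF n])
    \<comment> \<open>Of the 3 in the numerator, 1 comes from the mass missing at the ends and 2
      from the capture bound.\<close>
    moreover have "2 * (1 - (real t + 3) / n) = 2 - 2 / n - 2 * (real t + 2) / n"
      using n by (simp add: field_simps)
    ultimately have "2 * (1 - (real t + 3) / n) \<le> 2 * measure (drunk_walk (path_graph n)) (?U t)"
      using measure_degree_walk_path_le[OF n sets_captured(2), of t ?X]
        measure_degree_walk_captured[OF assms, of t] by simp
    then show ?thesis by (rule mult_left_le_imp_le) simp
  qed
  \<comment> \<open>The bound \<open>1 - (t + 3) / n\<close> reaches 0 at \<open>t = n - 3\<close>,
    so the sum stops there. For \<open>n < 3\<close> the sum is empty and the required bound is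
    negative.\<close>
  define m where "m = n - 3"
  have "(real n - 5) / 2 \<le> (\<Sum>t<m. 1 - (real t + 3) / n)"
  proof -
    have sum: "(\<Sum>t<k. 1 - (real t + 3) / n) = k - (real k * (real k + 5) / 2) / n" for k
    proof (induction k)
      case (Suc k)
      show ?case unfolding sum.lessThan_Suc Suc.IH using n by (simp add: field_simps)
    qed simp
    show ?thesis
    proof (cases "n \<ge> 3")
      case True
      then have m: "real n = real m + 3" by (simp add: m_def of_nat_diff)
      show ?thesis unfolding sum unfolding m by (simp add: field_simps)
    next
      case False
      then show ?thesis by (simp add: m_def)
    qed
  qed
  also have "\<dots> \<le> (\<Sum>t<m. measure (drunk_walk (path_graph n)) (?U t))"
    by (intro sum_mono U)
  finally have "ennreal ((real n - 5) / 2) \<le> ennreal (\<Sum>t<m. measure (drunk_walk (path_graph n)) (?U t))"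
    by (rule ennreal_leI)
  also have "\<dots> = (\<Sum>t<m. emeasure (drunk_walk (path_graph n)) (?U t))"
    by (simp add: drunk_walk.emeasure_eq_measure)
  also have "\<dots> = (\<integral>\<^sup>+Y. (\<Sum>t<m. indicator (?U t) Y) \<partial>drunk_walk (path_graph n))"
    using sets_captured(2)[of _ ?X "path_graph n"] by (subst nn_integral_sum) simp_all
  also have "\<dots> \<le> (\<integral>\<^sup>+Y. capture_time ?X Y \<partial>drunk_walk (path_graph n))"
    unfolding sum_not_captured by (intro nn_integral_mono) simp
  finally show ?thesis .
qed


section \<open>Strategies of the cops\<close>

text \<open>The index set no longer depends on \<open>X\<close> and \<open>Y\<close>, so
  measurability follows from that of a countable infimum.\<close>

lemma capture_time_INF:
  "capture_time X Y = (INF t. if captured X Y t then of_nat t else top)"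
proof (rule antisym)
  show "capture_time X Y \<le> (INF t. if captured X Y t then of_nat t else top)"
    unfolding capture_time_def by (rule INF_greatest) (auto intro: INF_lower)
  show "(INF t. if captured X Y t then of_nat t else top) \<le> capture_time X Y"
    unfolding capture_time_def
  proof (rule INF_greatest)
    fix t assume "t \<in> {t. captured X Y t}"
    then show "(INF t. if captured X Y t then of_nat t else top) \<le> (of_nat t :: ennreal)"
      by (intro INF_lower2[of t]) auto
  qed
qed

lemma measurable_capture_time:
  fixes G :: "'a::countable graph"
  assumes M: "sets M = sets (PiM UNIV (\<lambda>_. count_space P))"
  shows "(\<lambda>(X, Y). capture_time X Y) \<in> borel_measurable (M \<Otimes>\<^sub>M drunk_walk G)"
proof -
  let ?N = "M \<Otimes>\<^sub>M drunk_walk G"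
  have "(\<lambda>X. X t) \<in> measurable M (count_space P)" for t
    by (simp add: measurable_cong_sets[OF M refl])
  then have [measurable]: "(\<lambda>X. X t) \<in> measurable M (count_space UNIV)" for t
    by (rule measurable_compose) simp
  have event: "Measurable.pred ?N (\<lambda>p. snd p s \<in> set (fst p t))" for s t
  proof -
    \<comment> \<open>Vertices and lists of vertices are countable, so their product is discrete and
      membership is a measurable relation.\<close>
    have "(\<lambda>p. (snd p s, fst p t)) \<in> measurable ?N (count_space UNIV \<Otimes>\<^sub>M count_space UNIV)"
      by measurable
    then have "(\<lambda>p. (snd p s, fst p t)) \<in> measurable ?N (count_space UNIV)"
      by (simp add: pair_measure_countable)
    from measurable_compose[OF this, of "\<lambda>(y, x). y \<in> set x" "count_space UNIV"]
    show ?thesis by simp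
  qed
  note [measurable] = event
  have "(\<lambda>p. INF t. if captured (fst p) (snd p) t then of_nat t else top :: ennreal) \<in> borel_measurable ?N"
    unfolding captured_def by (intro borel_measurable_INF measurable_If) measurable
  then show ?thesis by (simp add: capture_time_INF case_prod_beta')
qed

text \<open>Equality of two walks is a countable conjunction of equalities of coordinates, hence a
  measurable event.\<close>

lemma AE_return_eq:
  fixes X :: "nat \<Rightarrow> 'a"
  assumes "\<And>t. X t \<in> P"
  shows "AE X' in return (PiM UNIV (\<lambda>_. count_space P)) X. X' = X"
proof -
  let ?P = "PiM UNIV (\<lambda>_. count_space P)"
  have sp: "X \<in> space ?P" using assms by (simp add: space_PiM PiE_def)
  have "Measurable.pred ?P (\<lambda>X'. X' t = X t)" for t
    by (rule measurable_compose[OF measurable_component_singleton]) simp_all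
  then have "Measurable.pred ?P (\<lambda>X'. \<forall>t. X' t = X t)"
    by (intro pred_intros_countable)
  from AE_return[OF sp this] show ?thesis by (simp add: fun_eq_iff)
qed

lemma return_mem_cop_strategies:
  assumes X: "\<And>t. X t \<in> cop_positions G k" and move: "\<And>t. cop_move G (X t) (X (Suc t))"
  shows "return (PiM UNIV (\<lambda>_. count_space (cop_positions G k))) X \<in> cop_strategies G k (X 0)"
proof -
  let ?P = "PiM UNIV (\<lambda>_. count_space (cop_positions G k))"
  have "X \<in> space ?P" using X by (simp add: space_PiM PiE_def)
  moreover have "AE X' in return ?P X. X' 0 = X 0 \<and> (\<forall>t. cop_move G (X' t) (X' (Suc t)))"
    using AE_return_eq[OF X] by eventually_elim (simp add: move)
  ultimately show ?thesis
    using prob_space_return by (simp add: cop_strategies_def)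
qed

lemma nn_integral_capture_time_return:
  fixes G :: "'a::countable graph"
  assumes "\<And>t. X t \<in> P"
  shows "(\<integral>\<^sup>+(X', Y). capture_time X' Y \<partial>(return (PiM UNIV (\<lambda>_. count_space P)) X \<Otimes>\<^sub>M drunk_walk G)) =
    (\<integral>\<^sup>+Y. capture_time X Y \<partial>drunk_walk G)"
proof -
  let ?P = "PiM UNIV (\<lambda>_. count_space P)"
  have sp: "X \<in> space ?P" using assms by (simp add: space_PiM PiE_def)
  have meas: "(\<lambda>(X, Y). capture_time X Y) \<in> borel_measurable (return ?P X \<Otimes>\<^sub>M drunk_walk G)"
    "(\<lambda>(X, Y). capture_time X Y) \<in> borel_measurable (?P \<Otimes>\<^sub>M drunk_walk G)"
    by (rule measurable_capture_time[of _ P], simp)+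
  show ?thesis
    using drunk_walk.nn_integral_fst[OF meas(1)] drunk_walk.borel_measurable_nn_integral_fst[OF meas(2)]
    by (simp add: nn_integral_return[OF sp])
qed

text \<open>Moves preserve the number of cops, so almost every outcome of a randomized strategy is a
  walk of a single vertex. Bounds for deterministic walks can then be integrated over the
  strategy.\<close>

lemma cop_strategies_AE_path:
  assumes "x \<in> cop_positions (path_graph n) 1" "M \<in> cop_strategies (path_graph n) 1 x"
  shows "AE X in M. \<exists>c. X = (\<lambda>t. [c t]) \<and> [c 0] = x \<and> c 0 < n \<and> (\<forall>t. move (path_graph n) (c t) (c (Suc t)))"
proof -
  have "AE X in M. X 0 = x \<and> (\<forall>t. cop_move (path_graph n) (X t) (X (Suc t)))"
    using assms by (simp add: cop_strategies_def)
  then show ?thesis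
  proof eventually_elim
    case (elim X)
    have "length (X t) = 1" for t
    proof (induction t)
      case 0
      then show ?case using elim assms by (simp add: cop_positions_def)
    next
      case (Suc t)
      then show ?case using elim list_all2_lengthD[of "move (path_graph n)" "X t" "X (Suc t)"]
        by (simp add: cop_move_def)
    qed
    then have X: "X t = [hd (X t)]" for t
      by (metis One_nat_def length_0_conv length_Suc_conv list.sel(1))
    have "move (path_graph n) (hd (X t)) (hd (X (Suc t)))" for t
    proof -
      have "cop_move (path_graph n) [hd (X t)] [hd (X (Suc t))]"
        using elim X[of t] X[of "Suc t"] by metis
      then show ?thesis by (simp add: cop_move_def)
    qed
    moreover have "hd (X 0) < n"
      using X[of 0] elim assms by (cases x) (auto simp: cop_positions_def)
    moreover have "[hd (X 0)] = x" using X[of 0] elim by simp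
    ultimately show ?case
      using X by (intro exI[of _ "\<lambda>t. hd (X t)"]) auto
  qed
qed

text \<open>The lower bound is uniform over all cop walks. By independence the robber can be
  integrated out first, so randomizing does not help the cop.\<close>

lemma idct_path_graph_ge:
  assumes n: "n \<ge> 2"
  shows "ennreal ((real n - 5) / 2) \<le> idct (path_graph n)"
proof -
  have "ennreal ((real n - 5) / 2) \<le> (\<integral>\<^sup>+(X, Y). capture_time X Y \<partial>(M \<Otimes>\<^sub>M drunk_walk (path_graph n)))"
    if x: "x \<in> cop_positions (path_graph n) 1" and M: "M \<in> cop_strategies (path_graph n) 1 x" for x M
  proof -
    interpret M: prob_space M using M by (simp add: cop_strategies_def)
    have sets_M: "sets M = sets (PiM UNIV (\<lambda>_. count_space (cop_positions (path_graph n) 1)))"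
      using M by (simp add: cop_strategies_def)
    have "ennreal ((real n - 5) / 2) = (\<integral>\<^sup>+X. ennreal ((real n - 5) / 2) \<partial>M)"
      by (simp add: M.emeasure_space_1)
    also have "\<dots> \<le> (\<integral>\<^sup>+X. (\<integral>\<^sup>+Y. capture_time X Y \<partial>drunk_walk (path_graph n)) \<partial>M)"
      using cop_strategies_AE_path[OF x M]
    proof (intro nn_integral_mono_AE, eventually_elim)
      case (elim X)
      then show ?case using nn_integral_capture_time_path_ge[OF n] by auto
    qed
    also have "\<dots> = (\<integral>\<^sup>+(X, Y). capture_time X Y \<partial>(M \<Otimes>\<^sub>M drunk_walk (path_graph n)))"
      using drunk_walk.nn_integral_fst[OF measurable_capture_time[OF sets_M, of "path_graph n"]] by simp
    finally show ?thesis .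
  qed
  then show ?thesis
    using n by (simp add: idct_def idct_k_def idct_k_from_def cop_number_path_graph INF_greatest)
qed


section \<open>The sweeping cop\<close>

lemma AE_drunk_walk_step:
  fixes G :: "'a::countable graph"
  shows "AE Y in drunk_walk G. Y 0 \<in> set_pmf (pmf_of_set (verts G)) \<and>
    (\<forall>t. Y (Suc t) \<in> set_pmf (drunk_step G (Y t)))"
proof -
  have "AE Y in drunk_walk G. Y 0 \<in> set_pmf (pmf_of_set (verts G))"
  proof -
    have "(\<integral>\<^sup>+Y. indicator (- set_pmf (pmf_of_set (verts G))) (Y 0) \<partial>drunk_walk G) =
        (\<integral>\<^sup>+v. indicator (- set_pmf (pmf_of_set (verts G))) v \<partial>measure_pmf (pmf_of_set (verts G)))"
      by (rule nn_integral_drunk_walk_0)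
    also have "\<dots> = 0"
      by (subst nn_integral_0_iff_AE) (auto simp: AE_measure_pmf_iff)
    finally show ?thesis
      by (subst (asm) nn_integral_0_iff_AE)
        (auto intro!: measurable_compose[OF measurable_drunk_walk_component] simp: indicator_eq_0_iff)
  qed
  moreover have "AE Y in drunk_walk G. Y (Suc t) \<in> set_pmf (drunk_step G (Y t))" for t
  proof -
    let ?B = "{Y. Y (Suc t) \<notin> set_pmf (drunk_step G (Y t))}"
    have B: "?B \<in> sets (drunk_walk G)"
      using sets_walk_event[of "\<lambda>a b. b \<notin> set_pmf (drunk_step G a)" t "Suc t"] by simp
    \<comment> \<open>Resampling the position after the step makes an illegal step a null event for
      each fixed history.\<close>
    have "(\<integral>\<^sup>+Y. indicator ?B Y \<partial>drunk_walk G) =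
      (\<integral>\<^sup>+Y. (\<integral>\<^sup>+w. indicator ?B (Y(Suc t := w)) \<partial>measure_pmf (drunk_step G (Y t))) \<partial>drunk_walk G)"
      by (rule nn_integral_drunk_walk_Suc) (simp add: indicator_def)
    also have "\<dots> = (\<integral>\<^sup>+Y. 0 \<partial>drunk_walk G)"
      by (intro nn_integral_cong, subst nn_integral_0_iff_AE) (auto simp: AE_measure_pmf_iff indicator_def)
    finally have "emeasure (drunk_walk G) ?B = 0" using B by simp
    then show ?thesis using B by (intro AE_I[of _ _ ?B]) auto
  qed
  ultimately show ?thesis by (simp add: AE_all_countable)
qed

lemma AE_drunk_walk_robber_walks:
  assumes "n \<ge> 1"
  shows "AE Y in drunk_walk (path_graph n). Y \<in> robber_walks (path_graph n)"
  using AE_drunk_walk_step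
proof eventually_elim
  case (elim Y)
  have "move (path_graph n) v w" if "w \<in> set_pmf (drunk_step (path_graph n) v)" for v w
    using that by (auto simp: drunk_step_def move_def split: if_splits)
  with elim show ?case using assms by (simp add: robber_walks_def lessThan_empty_iff)
qed

lemma robber_walks_path_lt:
  assumes "Y \<in> robber_walks (path_graph n)"
  shows "Y t < n"
proof (induction t)
  case 0
  then show ?case using assms by (simp add: robber_walks_def)
next
  case (Suc t)
  then show ?case using assms move_path_graph[of "Y t" n "Y (Suc t)"] by (simp add: robber_walks_def)
qed

definition sweep :: "nat \<Rightarrow> nat \<Rightarrow> nat list" where
  "sweep n t = [min t (n - 1)]"

lemma sweep_mem_cop_positions: "n \<ge> 1 \<Longrightarrow> sweep n t \<in> cop_positions (path_graph n) 1"
  by (auto simp: sweep_def cop_positions_def)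

lemma cop_move_sweep: "n \<ge> 1 \<Longrightarrow> cop_move (path_graph n) (sweep n t) (sweep n (Suc t))"
  by (auto simp: sweep_def cop_move_def move_path_graph min_def)

text \<open>A robber to the right of the cop cannot pass him without being on vertex
  \<open>Suc t\<close> either when the cop arrives or after his own move. The bound on
  \<open>t\<close> keeps the cop's position equal to \<open>t\<close>.\<close>

lemma sweep_not_captured:
  assumes Y: "Y \<in> robber_walks (path_graph n)"
    and free: "\<And>s. s \<le> t \<Longrightarrow> \<not> captured (sweep n) Y s" and t: "t \<le> n - 1"
  shows "t < Y t"
  using free t
proof (induction t)
  case 0
  then show ?case using 0(1)[of 0] by (simp add: captured_def sweep_def)
next
  case (Suc t)
  have "t < Y t" using Suc by simp
  moreover have "Y (Suc t) \<noteq> Suc t" "Y t \<noteq> Suc t"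
    using Suc.prems(1)[of "Suc t"] Suc.prems(2) by (simp_all add: captured_def sweep_def min_def)
  moreover have "Y t \<le> Suc (Y (Suc t))"
    using Y move_path_graph[OF robber_walks_path_lt[OF Y], of t "Y (Suc t)"] by (auto simp: robber_walks_def)
  ultimately show ?case by linarith
qed

text \<open>A robber still free after round \<open>n - 1\<close> would have to be beyond the last
  vertex.\<close>

lemma capture_time_sweep:
  assumes Y: "Y \<in> robber_walks (path_graph n)"
  shows "capture_time (sweep n) Y \<le> of_nat (n - 1)"
proof -
  have "\<exists>s\<le>n - 1. captured (sweep n) Y s"
    using sweep_not_captured[OF Y, of "n - 1"] robber_walks_path_lt[OF Y, of "n - 1"] by fastforce
  then obtain s where s: "s \<le> n - 1" "captured (sweep n) Y s" by blast
  have "capture_time (sweep n) Y \<le> of_nat s"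
    unfolding capture_time_def using s by (intro INF_lower) simp
  also have "\<dots> \<le> of_nat (n - 1)" using s by simp
  finally show ?thesis .
qed

section \<open>Expected duration of the sweep against the drunk robber\<close>

text \<open>At an inner vertex the robber's step has mean 0, so the cop's step shortens the expected
  distance by 1. At the last vertex the robber must step towards the cop. The gap of 2 keeps the
  truncated subtraction exact.\<close>

lemma drunk_step_path_graph_drift:
  assumes "t + 2 \<le> v" "v < n"
  shows "1 + (\<integral>\<^sup>+w. of_nat (w - Suc t) \<partial>measure_pmf (drunk_step (path_graph n) v)) \<le> of_nat (v - t)"
proof (cases "v = n - 1")
  case True
  then have "neighbours (path_graph n) v = {v - 1}" using assms by (auto simp: neighbours_path_graph)
  moreover have "1 + of_nat (v - 1 - Suc t) = (of_nat (v - Suc t) :: ennreal)"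
    using assms by (simp flip: of_nat_Suc)
  ultimately show ?thesis using assms by (simp add: drunk_step_def pmf_of_set_singleton)
next
  case False
  then have nb: "neighbours (path_graph n) v = {v - 1, Suc v}" using assms by (auto simp: neighbours_path_graph)
  have "(\<integral>\<^sup>+w. of_nat (w - Suc t) \<partial>measure_pmf (drunk_step (path_graph n) v)) =
    (of_nat (v - 1 - Suc t) + of_nat (Suc v - Suc t)) / (2 :: ennreal)"
    using assms by (simp add: drunk_step_def nb nn_integral_pmf_of_set)
  also have "\<dots> = of_nat (v - t - 1)"
  proof -
    have "real (v - 1 - Suc t) + real (Suc v - Suc t) = 2 * real (v - t - 1)" using assms by simp
    then show ?thesis
      by (simp add: ennreal_of_nat_eq_real_of_nat ennreal_plus[symmetric] divide_ennreal[of _ 2, simplified] del: ennreal_plus)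
  qed
  finally show ?thesis using assms by (simp flip: of_nat_Suc)
qed

text \<open>The expected distance on survival, \<open>\<Phi>\<close>, is a potential: each round
  lowers it by at least the probability of being free before that round. Telescoping bounds the tail
  sum by \<open>\<Phi> 0\<close>, hence by the mean of the initial vertex.\<close>

lemma nn_integral_capture_time_sweep_le:
  assumes n: "n \<ge> 1"
  shows "(\<integral>\<^sup>+Y. capture_time (sweep n) Y \<partial>drunk_walk (path_graph n)) \<le> ennreal ((real n - 1) / 2)"
proof -
  let ?M = "drunk_walk (path_graph n)"
  define U where "U t = {Y. \<forall>s\<le>t. \<not> captured (sweep n) Y s}" for t
  define \<Phi> where "\<Phi> t = (\<integral>\<^sup>+Y. indicator (U t) Y * of_nat (Y t - t) \<partial>?M)" for t
  have [measurable]: "U t \<in> sets ?M" for t unfolding U_def by (rule sets_captured)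
  have [measurable]: "(\<lambda>Y. of_nat (Y t - t) :: ennreal) \<in> borel_measurable ?M" for t
    by (rule measurable_compose[OF measurable_drunk_walk_component]) simp
  have walk: "AE Y in ?M. Y \<in> robber_walks (path_graph n)"
    by (rule AE_drunk_walk_robber_walks[OF n])
  have step: "\<Phi> (Suc t) + emeasure ?M (U t) \<le> \<Phi> t" if t: "t < n - 1" for t
  proof -
    let ?F = "\<lambda>Y. indicator (U (Suc t)) Y * of_nat (Y (Suc t) - Suc t) :: ennreal"
    let ?K = "\<lambda>Y. measure_pmf (drunk_step (path_graph n) (Y t))"
    have U_cong: "Y \<in> U s \<longleftrightarrow> Y' \<in> U s" if same: "\<And>i. i \<le> s \<Longrightarrow> Y i = Y' i" for Y Y' s
    proof -
      have "captured (sweep n) Y r = captured (sweep n) Y' r" if "r \<le> s" for r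
        by (rule captured_cong, rule same) (use that in linarith)
      then show ?thesis unfolding U_def mem_Collect_eq by blast
    qed
    have "\<Phi> (Suc t) + emeasure ?M (U t) = (\<integral>\<^sup>+Y. ?F Y + indicator (U t) Y \<partial>?M)"
      unfolding \<Phi>_def by (subst nn_integral_add) simp_all
    also have "\<dots> = (\<integral>\<^sup>+Y. (\<integral>\<^sup>+w. ?F (Y(Suc t := w)) + indicator (U t) (Y(Suc t := w)) \<partial>?K Y) \<partial>?M)"
    proof (rule nn_integral_drunk_walk_Suc)
      fix Y Y' :: "nat \<Rightarrow> nat" assume eq: "\<And>i. i \<le> Suc t \<Longrightarrow> Y i = Y' i"
      show "?F Y + indicator (U t) Y = ?F Y' + indicator (U t) Y'"
        using U_cong[of "Suc t" Y Y', OF eq] U_cong[of t Y Y', OF eq] eq[of "Suc t"]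
        by (simp add: indicator_def)
    qed
    also have "\<dots> \<le> \<Phi> t"
      unfolding \<Phi>_def
    proof (intro nn_integral_mono_AE eventually_mono[OF walk])
      fix Y assume Y: "Y \<in> robber_walks (path_graph n)"
      have U_upd: "Y(Suc t := w) \<in> U t \<longleftrightarrow> Y \<in> U t" for w
        by (rule U_cong) simp
      show "(\<integral>\<^sup>+w. ?F (Y(Suc t := w)) + indicator (U t) (Y(Suc t := w)) \<partial>?K Y)
        \<le> indicator (U t) Y * of_nat (Y t - t)"
      proof (cases "Y \<in> U t")
        case True
        then have "t < Y t" using t by (intro sweep_not_captured[OF Y]) (auto simp: U_def)
        have "(\<integral>\<^sup>+w. ?F (Y(Suc t := w)) + indicator (U t) (Y(Suc t := w)) \<partial>?K Y) =
            1 + (\<integral>\<^sup>+w. ?F (Y(Suc t := w)) \<partial>?K Y)"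
          using U_upd True by (subst nn_integral_add) (simp_all add: measure_pmf.emeasure_space_1)
        also have "\<dots> \<le> of_nat (Y t - t)"
        proof (cases "Y t = Suc t")
          \<comment> \<open>A robber next to the cop is caught by the cop's next move wherever he
            would step, so no distance remains and the distance 1 pays for this round.\<close>
          case True
          then have "captured (sweep n) (Y(Suc t := w)) (Suc t)" for w
            using t by (simp add: captured_def sweep_def)
          then have "Y(Suc t := w) \<notin> U (Suc t)" for w by (auto simp: U_def)
          then show ?thesis using True by simp
        next
          case False
          have "1 + (\<integral>\<^sup>+w. ?F (Y(Suc t := w)) \<partial>?K Y) \<le> 1 + (\<integral>\<^sup>+w. of_nat (w - Suc t) \<partial>?K Y)"
            by (intro add_left_mono nn_integral_mono) (simp add: indicator_def)
          also have "\<dots> \<le> of_nat (Y t - t)"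
            using \<open>t < Y t\<close> False by (intro drunk_step_path_graph_drift robber_walks_path_lt[OF Y]) simp
          finally show ?thesis .
        qed
        finally show ?thesis using True by (simp add: indicator_def)
      next
        case False
        have "Y(Suc t := w) \<notin> U (Suc t)" for w
          using False U_upd[of w] by (auto simp: U_def)
        then show ?thesis
          unfolding indicator_def U_upd using False by simp
      qed
    qed
    finally show ?thesis .
  qed
  have sum: "m \<le> n - 1 \<Longrightarrow> (\<Sum>t<m. emeasure ?M (U t)) + \<Phi> m \<le> \<Phi> 0" for m
  proof (induction m)
    case (Suc m)
    have "(\<Sum>t<Suc m. emeasure ?M (U t)) + \<Phi> (Suc m) = (\<Sum>t<m. emeasure ?M (U t)) + (\<Phi> (Suc m) + emeasure ?M (U m))"
      by (simp add: ac_simps)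
    also have "\<dots> \<le> (\<Sum>t<m. emeasure ?M (U t)) + \<Phi> m"
      using Suc.prems by (intro add_left_mono step) simp
    also have "\<dots> \<le> \<Phi> 0" using Suc by simp
    finally show ?case .
  qed simp
  \<comment> \<open>The sweep ends by round \<open>n - 1\<close>, so truncating the tail sum there
    loses nothing.\<close>
  have "(\<integral>\<^sup>+Y. capture_time (sweep n) Y \<partial>?M) \<le> (\<integral>\<^sup>+Y. (\<Sum>t<n - 1. indicator (U t) Y) \<partial>?M)"
    unfolding U_def sum_not_captured
  proof (intro nn_integral_mono_AE eventually_mono[OF walk])
    fix Y assume "Y \<in> robber_walks (path_graph n)"
    then show "capture_time (sweep n) Y \<le> min (capture_time (sweep n) Y) (of_nat (n - 1))"
      using capture_time_sweep by simp
  qed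
  also have "\<dots> = (\<Sum>t<n - 1. emeasure ?M (U t))"
    by (subst nn_integral_sum) simp_all
  also have "\<dots> \<le> \<Phi> 0"
    using sum[of "n - 1"] by (auto intro: order_trans[rotated])
  also have "\<dots> \<le> (\<integral>\<^sup>+Y. of_nat (Y 0) \<partial>?M)"
    unfolding \<Phi>_def by (intro nn_integral_mono) (simp add: indicator_def)
  also have "\<dots> = (\<integral>\<^sup>+v. of_nat v \<partial>measure_pmf (pmf_of_set {..<n}))"
    using nn_integral_drunk_walk_0[of "path_graph n" of_nat] by simp
  also have "\<dots> = (\<Sum>v<n. of_nat v) / of_nat n"
    using n by (subst nn_integral_pmf_of_set) (auto simp: lessThan_empty_iff)
  also have "(\<Sum>v<n. of_nat v :: ennreal) = ennreal (real n * (real n - 1) / 2)"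
  proof -
    have "(\<Sum>v<n. real v) = real n * (real n - 1) / 2"
      by (induction n) (simp_all add: field_simps)
    moreover have "(\<Sum>v<n. of_nat v :: ennreal) = ennreal (\<Sum>v<n. real v)"
      by (simp add: ennreal_of_nat_eq_real_of_nat)
    ultimately show ?thesis by (simp only:)
  qed
  also have "ennreal (real n * (real n - 1) / 2) / of_nat n = ennreal ((real n - 1) / 2)"
    using n by (simp add: ennreal_of_nat_eq_real_of_nat divide_ennreal)
  finally show ?thesis .
qed

lemma sweep_mem_cop_strategies:
  assumes "n \<ge> 1"
  shows "return (PiM UNIV (\<lambda>_. count_space (cop_positions (path_graph n) 1))) (sweep n)
    \<in> cop_strategies (path_graph n) 1 (sweep n 0)"
  using assms by (intro return_mem_cop_strategies sweep_mem_cop_positions cop_move_sweep)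

lemma idct_path_graph_le:
  assumes n: "n \<ge> 1"
  shows "idct (path_graph n) \<le> ennreal ((real n - 1) / 2)"
proof -
  have "idct (path_graph n) \<le> idct_k_from (path_graph n) 1 (sweep n 0)"
    unfolding idct_def idct_k_def cop_number_path_graph[OF n]
    by (intro INF_lower sweep_mem_cop_positions n)
  also have "\<dots> \<le> (\<integral>\<^sup>+(X, Y). capture_time X Y
      \<partial>(return (PiM UNIV (\<lambda>_. count_space (cop_positions (path_graph n) 1))) (sweep n)
        \<Otimes>\<^sub>M drunk_walk (path_graph n)))"
    unfolding idct_k_from_def by (intro INF_lower sweep_mem_cop_strategies n)
  also have "\<dots> = (\<integral>\<^sup>+Y. capture_time (sweep n) Y \<partial>drunk_walk (path_graph n))"
    by (intro nn_integral_capture_time_return sweep_mem_cop_positions n)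
  also have "\<dots> \<le> ennreal ((real n - 1) / 2)"
    by (rule nn_integral_capture_time_sweep_le[OF n])
  finally show ?thesis .
qed


section \<open>The adversarial robber\<close>

text \<open>Whatever the robber's strategy, its response to a cop walk is a robber walk, and the
  sweep catches every such walk by round \<open>n - 1\<close>.\<close>

lemma ict_path_graph_le:
  assumes n: "n \<ge> 1"
  shows "ict (path_graph n) \<le> of_nat (n - 1)"
proof -
  let ?M = "return (PiM UNIV (\<lambda>_. count_space (cop_positions (path_graph n) 1))) (sweep n)"
  interpret M: prob_space ?M
    using sweep_mem_cop_strategies[OF n]
    by (simp add: cop_strategies_def)
  have "ict (path_graph n) \<le> (INF M\<in>cop_strategies (path_graph n) 1 (sweep n 0).
      SUP y\<in>verts (path_graph n). ict_against (path_graph n) M y)"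
    unfolding ict_def ict_k_def cop_number_path_graph[OF n]
    by (intro INF_lower sweep_mem_cop_positions n)
  also have "\<dots> \<le> (SUP y\<in>verts (path_graph n). ict_against (path_graph n) ?M y)"
    by (intro INF_lower sweep_mem_cop_strategies n)
  also have "\<dots> \<le> of_nat (n - 1)"
    unfolding ict_against_def
  proof (intro SUP_least)
    fix y \<rho> assume y: "y \<in> verts (path_graph n)" and \<rho>: "\<rho> \<in> robber_strategies (path_graph n) y"
    have "robber_response \<rho> X \<in> robber_walks (path_graph n)" for X
    proof -
      have "move (path_graph n) (robber_response \<rho> X t) (robber_response \<rho> X (Suc t))" for t
        using \<rho> unfolding robber_strategies_def robber_response_def upt_Suc_append[OF le0, of "Suc t"]
        by (simp del: upt_Suc)
      moreover have "robber_response \<rho> X 0 = y"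
        using \<rho> by (simp add: robber_strategies_def robber_response_def)
      ultimately show ?thesis using y by (simp add: robber_walks_def)
    qed
    then have "(\<integral>\<^sup>+X. capture_time X (robber_response \<rho> X) \<partial>?M) \<le> (\<integral>\<^sup>+X. of_nat (n - 1) \<partial>?M)"
      by (intro nn_integral_mono_AE eventually_mono[OF AE_return_eq[OF sweep_mem_cop_positions[OF n]]])
        (simp add: capture_time_sweep del: One_nat_def)
    also have "\<dots> = of_nat (n - 1)"
      by (simp only: nn_integral_const M.emeasure_space_1 mult_1_right)
    finally show "(\<integral>\<^sup>+X. capture_time X (robber_response \<rho> X) \<partial>?M) \<le> of_nat (n - 1)" .
  qed
  finally show ?thesis .
qed

lemma path_dist_le:
  assumes "\<And>t. move (path_graph n) (c t) (c (Suc t))"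
  shows "c (s + k) \<le> c s + k \<and> c s \<le> c (s + k) + k"
proof (induction k)
  case (Suc k)
  have "c (Suc (s + k)) \<le> Suc (c (s + k)) \<and> c (s + k) \<le> Suc (c (Suc (s + k)))"
    using assms[of "s + k"] by (auto simp: move_def neighbours_path_graph)
  then show ?case using Suc by auto
qed simp

text \<open>Whichever end the cop reaches first, he needs another \<open>N\<close> rounds to reach the other one. The weights are
  chosen so that both cases give the same bound.\<close>

lemma capture_time_ends:
  fixes c :: "nat \<Rightarrow> nat"
  assumes c0: "c 0 \<le> N" and c: "\<And>t. move (path_graph (Suc N)) (c t) (c (Suc t))"
  shows "of_nat (N * N) \<le> of_nat (N - c 0) * capture_time (\<lambda>t. [c t]) (\<lambda>_. N)
    + of_nat (c 0) * capture_time (\<lambda>t. [c t]) (\<lambda>_. 0)"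
proof -
  have cap: "captured (\<lambda>t. [c t]) (\<lambda>_. y) t \<longleftrightarrow> c t = y" for y t
    by (auto simp: captured_def)
  \<comment> \<open>An end that is never visited has infinite capture time, and its weight is
    positive because the cop does not start there.\<close>
  consider "\<And>t. c t \<noteq> N" | "\<And>t. c t \<noteq> 0" | a b where "c a = N" "c b = 0" by blast
  then show ?thesis
  proof cases
    case 1
    then have "capture_time (\<lambda>t. [c t]) (\<lambda>_. N) = top" by (intro capture_time_eq_top) (simp add: cap)
    moreover have "c 0 < N" using 1[of 0] c0 by simp
    ultimately show ?thesis by (simp add: ennreal_mult_top)
  next
    case 2
    then have "capture_time (\<lambda>t. [c t]) (\<lambda>_. 0) = top" by (intro capture_time_eq_top) (simp add: cap)
    moreover have "0 < c 0" using 2[of 0] by simp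
    ultimately show ?thesis by (simp add: ennreal_mult_top)
  next
    case 3
    define a b where "a = (LEAST t. c t = N)" and "b = (LEAST t. c t = 0)"
    have a: "c a = N" and b: "c b = 0"
      unfolding a_def b_def using 3 by (auto intro: LeastI)
    have ct: "capture_time (\<lambda>t. [c t]) (\<lambda>_. N) = of_nat a" "capture_time (\<lambda>t. [c t]) (\<lambda>_. 0) = of_nat b"
      using capture_time_Least[of "\<lambda>t. [c t]" "\<lambda>_. N"] capture_time_Least[of "\<lambda>t. [c t]" "\<lambda>_. 0"] 3
      by (auto simp: cap a_def b_def)
    obtain d where N: "N = c 0 + d" using c0 le_Suc_ex by blast
    have "N * N \<le> (N - c 0) * a + c 0 * b"
    proof (cases "a \<le> b")
      case True
      \<comment> \<open>From \<open>b \<ge> N + a\<close> the weighted sum is at least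
        \<open>N * a + N * c 0\<close>, and \<open>a \<ge> d\<close> finishes. The other case is
        symmetric.\<close>
      then have "N + a \<le> b" using path_dist_le[of "Suc N" c a "b - a", OF c] a b by simp
      then have "c 0 * (N + a) \<le> c 0 * b" by (rule mult_le_mono2)
      moreover have "d \<le> a" using path_dist_le[of "Suc N" c 0 a, OF c] a N by simp
      then have "N * d \<le> N * a" by (rule mult_le_mono2)
      ultimately show ?thesis by (simp add: N algebra_simps)
    next
      case False
      then have "N + b \<le> a" using path_dist_le[of "Suc N" c b "a - b", OF c] a b by simp
      then have "d * (N + b) \<le> d * a" by (rule mult_le_mono2)
      moreover have "c 0 \<le> b" using path_dist_le[of "Suc N" c 0 b, OF c] b by simp
      then have "N * c 0 \<le> N * b" by (rule mult_le_mono2)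
      ultimately show ?thesis by (simp add: N algebra_simps)
    qed
    then have "(of_nat (N * N) :: ennreal) \<le> of_nat ((N - c 0) * a + c 0 * b)" by (rule of_nat_mono)
    then show ?thesis by (simp add: ct)
  qed
qed

lemma measurable_capture_time_const:
  fixes Y :: "nat \<Rightarrow> 'a::countable"
  assumes M: "sets M = sets (PiM UNIV (\<lambda>_. count_space P))"
  shows "(\<lambda>X. capture_time X Y) \<in> borel_measurable M"
  using measurable_Pair1[OF measurable_capture_time[OF M, of undefined], of Y]
  by (simp add: case_prod_beta')

text \<open>The cop's start is fixed, so the weights of the two ends are constants and the pathwise
  inequality can be integrated. A robber waiting at either end is among those in the supremum, and
  the weights add up to \<open>N\<close>.\<close>

lemma ict_path_graph_ge:
  assumes n: "n \<ge> 1"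
  shows "of_nat (n - 1) \<le> ict (path_graph n)"
proof -
  define N where "N = n - 1"
  have "of_nat N \<le> (SUP y\<in>verts (path_graph n). ict_against (path_graph n) M y)" (is "_ \<le> ?S")
    if x: "x \<in> cop_positions (path_graph n) 1" and M: "M \<in> cop_strategies (path_graph n) 1 x" for x M
  proof (cases "N = 0")
    case False
    interpret M: prob_space M using M by (simp add: cop_strategies_def)
    have sets_M: "sets M = sets (PiM UNIV (\<lambda>_. count_space (cop_positions (path_graph n) 1)))"
      using M by (simp add: cop_strategies_def)
    note meas = measurable_capture_time_const[OF sets_M]
    obtain x0 where x0: "x = [x0]" "x0 \<le> N"
      using x n by (cases x) (auto simp: cop_positions_def N_def)
    have I: "(\<integral>\<^sup>+X. capture_time X (\<lambda>_. y) \<partial>M) \<le> ?S" if "y < n" for y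
    proof -
      have "(\<lambda>_. y) \<in> robber_strategies (path_graph n) y"
        by (simp add: robber_strategies_def move_def)
      then have "(\<integral>\<^sup>+X. capture_time X (robber_response (\<lambda>_. y) X) \<partial>M) \<le> ict_against (path_graph n) M y"
        unfolding ict_against_def by (rule SUP_upper)
      also have "\<dots> \<le> ?S" using that by (intro SUP_upper) simp
      finally show ?thesis by (simp add: robber_response_def[abs_def])
    qed
    have "of_nat (N * N) = (\<integral>\<^sup>+X. of_nat (N * N) \<partial>M)"
      by (simp add: M.emeasure_space_1)
    also have "\<dots> \<le> (\<integral>\<^sup>+X. of_nat (N - x0) * capture_time X (\<lambda>_. N) + of_nat x0 * capture_time X (\<lambda>_. 0) \<partial>M)"
    proof (intro nn_integral_mono_AE eventually_mono[OF cop_strategies_AE_path[OF x M]])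
      fix X assume "\<exists>c. X = (\<lambda>t. [c t]) \<and> [c 0] = x \<and> c 0 < n \<and> (\<forall>t. move (path_graph n) (c t) (c (Suc t)))"
      then obtain c where c: "X = (\<lambda>t. [c t])" "c 0 = x0" "\<And>t. move (path_graph n) (c t) (c (Suc t))"
        using x0 by auto
      have "Suc N = n" using n by (simp add: N_def)
      then show "of_nat (N * N) \<le> of_nat (N - x0) * capture_time X (\<lambda>_. N) + of_nat x0 * capture_time X (\<lambda>_. 0)"
        using capture_time_ends[of c N] c x0 by simp
    qed
    also have "\<dots> = of_nat (N - x0) * (\<integral>\<^sup>+X. capture_time X (\<lambda>_. N) \<partial>M) + of_nat x0 * (\<integral>\<^sup>+X. capture_time X (\<lambda>_. 0) \<partial>M)"
      using meas by (subst nn_integral_add) (simp_all add: nn_integral_cmult)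
    also have "\<dots> \<le> of_nat (N - x0) * ?S + of_nat x0 * ?S"
      using n False by (intro add_mono mult_left_mono I) (auto simp: N_def)
    also have "\<dots> = of_nat N * ?S"
      using x0 by (simp flip: distrib_right of_nat_add)
    finally have "of_nat N * of_nat N \<le> of_nat N * ?S" by simp
    then show ?thesis
      using False by (subst (asm) ennreal_mult_le_mult_iff) auto
  qed simp
  then show ?thesis
    by (simp add: ict_def ict_k_def cop_number_path_graph[OF n] INF_greatest N_def)
qed

lemma ict_path_graph: "n \<ge> 1 \<Longrightarrow> ict (path_graph n) = of_nat (n - 1)"
  by (intro antisym ict_path_graph_le ict_path_graph_ge)

section \<open>From the explicit bounds to the asymptotics\<close>

theorem theorem6p3:
  shows "(\<exists>f :: nat \<Rightarrow> real. f \<in> O(\<lambda>n. ln (real n) / real n) \<and>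
            (\<forall>n\<ge>1. ennreal (real n / 2 * (1 - f n)) \<le> idct (path_graph n) \<and>
                    idct (path_graph n) \<le> ennreal ((real n - 1) / 2)))
       \<and> (\<lambda>n. enn2real (idct (path_graph n))) \<sim>[at_top] (\<lambda>n. real n / 2)
       \<and> (\<lambda>n. cost_of_drunkenness_inv (path_graph n)) \<longlonglongrightarrow> 2"
proof (intro conjI)
  define r where "r n = enn2real (idct (path_graph n))" for n
  have r: "idct (path_graph n) = ennreal (r n)" if "n \<ge> 1" for n
    using le_less_trans[OF idct_path_graph_le[OF that] ennreal_less_top] by (simp add: r_def)
  have r_le: "r n \<le> (real n - 1) / 2" if "n \<ge> 1" for n
    using idct_path_graph_le[OF that] that unfolding r[OF that] by (subst (asm) ennreal_le_iff) simp_all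
  have r_ge: "(real n - 5) / 2 \<le> r n" if "n \<ge> 2" for n
  proof -
    have "ennreal ((real n - 5) / 2) \<le> ennreal (r n)"
      using idct_path_graph_ge[OF that] r[of n] that by simp
    then show ?thesis using ennreal_le_iff[of "r n" "(real n - 5) / 2"] by (simp add: r_def)
  qed
  show "\<exists>f :: nat \<Rightarrow> real. f \<in> O(\<lambda>n. ln (real n) / real n) \<and>
            (\<forall>n\<ge>1. ennreal (real n / 2 * (1 - f n)) \<le> idct (path_graph n) \<and>
                    idct (path_graph n) \<le> ennreal ((real n - 1) / 2))"
  proof (intro exI[of _ "\<lambda>n. 5 / real n"] conjI allI impI)
    \<comment> \<open>The error \<open>5 / n\<close> is what the lower bound
      \<open>(n - 5) / 2\<close> gives when written as \<open>n / 2 * (1 - f n)\<close>.\<close>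
    show "(\<lambda>n. 5 / real n) \<in> O(\<lambda>n. ln (real n) / real n)" by real_asymp
    fix n :: nat assume n: "n \<ge> 1"
    show "idct (path_graph n) \<le> ennreal ((real n - 1) / 2)" by (rule idct_path_graph_le[OF n])
    have eq: "real n / 2 * (1 - 5 / real n) = (real n - 5) / 2" using n by (simp add: field_simps)
    show "ennreal (real n / 2 * (1 - 5 / real n)) \<le> idct (path_graph n)"
    proof (cases "n = 1")
      case True
      \<comment> \<open>At \<open>n = 1\<close> the lower bound is negative, and
        \<open>ennreal\<close> sends it to 0.\<close>
      then show ?thesis by (simp add: ennreal_neg)
    next
      case False
      then show ?thesis unfolding eq using n by (intro idct_path_graph_ge) simp
    qed
  qed
  show "(\<lambda>n. enn2real (idct (path_graph n))) \<sim>[at_top] (\<lambda>n. real n / 2)"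
    unfolding r_def[symmetric]
  proof (rule asymp_equiv_sandwich_real)
    show "(\<lambda>n. (real n - 5) / 2) \<sim>[at_top] (\<lambda>n. real n / 2)" by real_asymp
    show "(\<lambda>n. (real n - 1) / 2) \<sim>[at_top] (\<lambda>n. real n / 2)" by real_asymp
    show "eventually (\<lambda>n. r n \<in> {(real n - 5) / 2..(real n - 1) / 2}) at_top"
      using eventually_ge_at_top[of 2]
    proof eventually_elim
      case (elim n)
      then show ?case using r_ge[of n] r_le[of n] by simp
    qed
  qed
  \<comment> \<open>From \<open>n = 6\<close> on, \<open>(n - 5) / 2\<close> is positive, so this
    quotient of reals represents the cost of drunkenness.\<close>
  have "(\<lambda>n. (real n - 1) / r n) \<longlonglongrightarrow> 2"
  proof (rule tendsto_sandwich)
    show "eventually (\<lambda>n. 2 \<le> (real n - 1) / r n) sequentially"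
      using eventually_ge_at_top[of 6]
    proof eventually_elim
      case (elim n)
      then have "0 < r n" using r_ge[of n] by simp
      then show ?case using r_le[of n] elim by (simp add: field_simps)
    qed
    show "eventually (\<lambda>n. (real n - 1) / r n \<le> (real n - 1) / ((real n - 5) / 2)) sequentially"
      using eventually_ge_at_top[of 6]
    proof eventually_elim
      case (elim n)
      then show ?case using r_ge[of n] by (intro divide_left_mono) simp_all
    qed
    show "(\<lambda>n. (real n - 1) / ((real n - 5) / 2)) \<longlonglongrightarrow> 2" by real_asymp
  qed simp
  then have "(\<lambda>n. ennreal ((real n - 1) / r n)) \<longlonglongrightarrow> ennreal 2"
    by (rule tendsto_ennrealI)
  moreover have "eventually (\<lambda>n. ennreal ((real n - 1) / r n) = cost_of_drunkenness_inv (path_graph n)) sequentially"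
    using eventually_ge_at_top[of 6]
  proof eventually_elim
    case (elim n)
    then have "0 < r n" using r_ge[of n] by simp
    then show ?case
      using elim by (simp add: cost_of_drunkenness_inv_def ict_path_graph r divide_ennreal
        ennreal_of_nat_eq_real_of_nat of_nat_diff)
  qed
  ultimately show "(\<lambda>n. cost_of_drunkenness_inv (path_graph n)) \<longlonglongrightarrow> 2"
    by (simp add: tendsto_cong)
qed

end
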